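(* Let $I,S,C\subseteq G$ be pairwise disjoint and suppose $I$ is AD-separated from $S$ by $C$. Then $X_I$ is epistemically h-irrelevant to $X_S$ conditional on $X_C$ with respect to the irrelevant natural extension, i.e. $$\underline{E}^{\mathrm{irr}}_G\big(f(X_S)\mid B_S,x_C,B_I\big)=\underline{E}^{\mathrm{irr}}_G\big(f(X_S)\mid B_S,x_C\big)$$ for all $f\in\mathcal{L}(\mathcal{X}_S)$, all nonempty $B_S\subseteq\mathcal{X}_S$, all $x_C\in\mathcal{X}_C$ and all nonempty $B_I\subseteq\mathcal{X}_I$.
   Context: Setting: $G$ is a finite set of nodes forming a DAG; node $s$ carries a variable $X_s$ with finite nonempty state space $\mathcal{X}_s$; $\mathcal{X}_S=\times_{s\in S}\mathcal{X}_s$; $\mathcal{L}(\mathcal{X}_S)$: real-valued functions on $\mathcal{X}_S$. $P(s)$: parents; $s\sqsubset v$: directed path of positive length from $s$ to $v$; $D(s)=\{v:s\sqsubset v\}$; $N(s)=G\setminus(\{s\}\cup D(s))$. Local models: nonempty closed convex sets $\mathcal{M}_{s\mid x_{P(s)}}$ of probability mass functions on $\mathcal{X}_s$. Full conditional probability measure on finite $\Omega$: $(A,B)\mapsto P(A\mid B)$ ($B\ne\emptyset$) with (F1) $P(\cdot\mid B)$ a probability measure, $P(B\mid B)=1$; (F2) $P(A\cap C\mid B)=P(A\mid C\cap B)P(C\mid B)$ if $C\cap B\ne\emptyset$. Irrelevant natural extension $\mathcal{F}^{\mathrm{irr}}_G$: all full conditional probability measures $P$ on $\mathcal{X}_G$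 with $P(X_s\mid x_{N(s)})\in\mathcal{M}_{s\mid x_{P(s)}}$ for all $s,x_{N(s)}$. For nonempty $B\subseteq\mathcal{X}_G$, $\underline{E}^{\mathrm{irr}}_G(f(X_S)\mid B)=\inf\{\sum_{z_S}f(z_S)P(z_S\mid B):P\in\mathcal{F}^{\mathrm{irr}}_G\}$; a conditioning expression $(B_S,x_C,B_I)$ is the event $\{z_G: z_S\in B_S, z_C=x_C, z_I\in B_I\}$. AD-separation: a path $s_1,\dots,s_n$ ($n\ge1$; consecutive nodes joined by an edge in either direction) is blocked by $C$ if (B1) $s_1\in C$; or (B2) some $1<i<n$ has $s_i\to s_{i+1}$ and $s_i\in C$; or (B3) some $1<i<n$ has $s_{i-1}\to s_i\leftarrow s_{i+1}$, $s_i\notin C$ and $D(s_i)\cap C=\emptyset$; or (B4) $s_n\in C$. $I$ is AD-separated from $S$ by $C$ if every path from any node of $I$ to any node of $S$ is blocked by $C$. *)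

theory Defs
  imports "HOL-Analysis.Analysis"
begin

text \<open>The DAG is given by a finite node set G and a parent map Pa (Pa s = parents of s).
  Joint states are extensional functions in PiE G Xs; a state of a subset S is an element
  of PiE S Xs (i.e. functions restricted to S).\<close>

definition edges :: "'n set \<Rightarrow> ('n \<Rightarrow> 'n set) \<Rightarrow> ('n \<times> 'n) set" where
  "edges G Pa = {(u, v). v \<in> G \<and> u \<in> Pa v}"

definition is_dag :: "'n set \<Rightarrow> ('n \<Rightarrow> 'n set) \<Rightarrow> bool" where
  "is_dag G Pa \<longleftrightarrow> finite G \<and> (\<forall>s\<in>G. Pa s \<subseteq> G) \<and> acyclic (edges G Pa)"

definition desc :: "'n set \<Rightarrow> ('n \<Rightarrow> 'n set) \<Rightarrow> 'n \<Rightarrow> 'n set" where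
  "desc G Pa s = {v. (s, v) \<in> (edges G Pa)\<^sup>+}"

definition nondesc :: "'n set \<Rightarrow> ('n \<Rightarrow> 'n set) \<Rightarrow> 'n \<Rightarrow> 'n set" where
  "nondesc G Pa s = G - ({s} \<union> desc G Pa s)"

definition pmfs_on :: "'v set \<Rightarrow> ('v \<Rightarrow> real) set" where
  "pmfs_on X = {p. (\<forall>x\<in>X. 0 \<le> p x) \<and> (\<forall>x. x \<notin> X \<longrightarrow> p x = 0) \<and> (\<Sum>x\<in>X. p x) = 1}"

definition full_cond_prob :: "'a set \<Rightarrow> ('a set \<Rightarrow> 'a set \<Rightarrow> real) \<Rightarrow> bool" where
  "full_cond_prob \<Omega> Pr \<longleftrightarrow>
     (\<forall>B. B \<subseteq> \<Omega> \<longrightarrow> B \<noteq> {} \<longrightarrow>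
        (\<forall>A. A \<subseteq> \<Omega> \<longrightarrow> 0 \<le> Pr A B)
      \<and> Pr \<Omega> B = 1
      \<and> (\<forall>A1 A2. A1 \<subseteq> \<Omega> \<longrightarrow> A2 \<subseteq> \<Omega> \<longrightarrow> A1 \<inter> A2 = {} \<longrightarrow>
            Pr (A1 \<union> A2) B = Pr A1 B + Pr A2 B)
      \<and> Pr B B = 1)
   \<and> (\<forall>A B C. A \<subseteq> \<Omega> \<longrightarrow> B \<subseteq> \<Omega> \<longrightarrow> C \<subseteq> \<Omega> \<longrightarrow> C \<inter> B \<noteq> {} \<longrightarrow>
        Pr (A \<inter> C) B = Pr A (C \<inter> B) * Pr C B)"

definition convex_fun_set :: "('v \<Rightarrow> real) set \<Rightarrow> bool" where
  "convex_fun_set K \<longleftrightarrow> (\<forall>p\<in>K. \<forall>q\<in>K. \<forall>u::real. 0 \<le> u \<longrightarrow> u \<le> 1 \<longrightarrow>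
      (\<lambda>x. u * p x + (1 - u) * q x) \<in> K)"

definition local_models_ok :: "'n set \<Rightarrow> ('n \<Rightarrow> 'n set) \<Rightarrow> ('n \<Rightarrow> 'v set)
     \<Rightarrow> ('n \<Rightarrow> ('n \<Rightarrow> 'v) \<Rightarrow> ('v \<Rightarrow> real) set) \<Rightarrow> bool" where
  "local_models_ok G Pa Xs M \<longleftrightarrow>
     (\<forall>s\<in>G. \<forall>x\<in>PiE (Pa s) Xs.
        M s x \<noteq> {} \<and> M s x \<subseteq> pmfs_on (Xs s) \<and> closed (M s x) \<and> convex_fun_set (M s x))"

definition irr_ext :: "'n set \<Rightarrow> ('n \<Rightarrow> 'n set) \<Rightarrow> ('n \<Rightarrow> 'v set)
     \<Rightarrow> ('n \<Rightarrow> ('n \<Rightarrow> 'v) \<Rightarrow> ('v \<Rightarrow> real) set)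
     \<Rightarrow> ((('n \<Rightarrow> 'v) set \<Rightarrow> ('n \<Rightarrow> 'v) set \<Rightarrow> real)) set" where
  "irr_ext G Pa Xs M = {Pr. full_cond_prob (PiE G Xs) Pr \<and>
     (\<forall>s\<in>G. \<forall>x\<in>PiE (nondesc G Pa s) Xs.
        (\<lambda>v. if v \<in> Xs s
              then Pr {z \<in> PiE G Xs. z s = v} {z \<in> PiE G Xs. \<forall>t\<in>nondesc G Pa s. z t = x t}
              else 0) \<in> M s (restrict x (Pa s)))}"

definition lower_exp_irr :: "'n set \<Rightarrow> ('n \<Rightarrow> 'n set) \<Rightarrow> ('n \<Rightarrow> 'v set)
     \<Rightarrow> ('n \<Rightarrow> ('n \<Rightarrow> 'v) \<Rightarrow> ('v \<Rightarrow> real) set)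
     \<Rightarrow> 'n set \<Rightarrow> (('n \<Rightarrow> 'v) \<Rightarrow> real) \<Rightarrow> ('n \<Rightarrow> 'v) set \<Rightarrow> real" where
  "lower_exp_irr G Pa Xs M S f B =
     Inf {(\<Sum>zS\<in>PiE S Xs. f zS * Pr {z \<in> PiE G Xs. restrict z S = zS} B) | Pr.
            Pr \<in> irr_ext G Pa Xs M}"

definition cond_event3 :: "'n set \<Rightarrow> ('n \<Rightarrow> 'v set) \<Rightarrow> 'n set \<Rightarrow> ('n \<Rightarrow> 'v) set
     \<Rightarrow> 'n set \<Rightarrow> ('n \<Rightarrow> 'v) \<Rightarrow> 'n set \<Rightarrow> ('n \<Rightarrow> 'v) set \<Rightarrow> ('n \<Rightarrow> 'v) set" where
  "cond_event3 G Xs S BS C xC I BI =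
     {z \<in> PiE G Xs. restrict z S \<in> BS \<and> (\<forall>c\<in>C. z c = xC c) \<and> restrict z I \<in> BI}"

definition cond_event2 :: "'n set \<Rightarrow> ('n \<Rightarrow> 'v set) \<Rightarrow> 'n set \<Rightarrow> ('n \<Rightarrow> 'v) set
     \<Rightarrow> 'n set \<Rightarrow> ('n \<Rightarrow> 'v) \<Rightarrow> ('n \<Rightarrow> 'v) set" where
  "cond_event2 G Xs S BS C xC =
     {z \<in> PiE G Xs. restrict z S \<in> BS \<and> (\<forall>c\<in>C. z c = xC c)}"

definition is_path :: "'n set \<Rightarrow> ('n \<Rightarrow> 'n set) \<Rightarrow> 'n list \<Rightarrow> bool" where
  "is_path G Pa ps \<longleftrightarrow> ps \<noteq> [] \<and> set ps \<subseteq> G \<and>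
     (\<forall>i. Suc i < length ps \<longrightarrow> ps ! i \<in> Pa (ps ! Suc i) \<or> ps ! Suc i \<in> Pa (ps ! i))"

definition blocked :: "'n set \<Rightarrow> ('n \<Rightarrow> 'n set) \<Rightarrow> 'n set \<Rightarrow> 'n list \<Rightarrow> bool" where
  "blocked G Pa C ps \<longleftrightarrow>
     hd ps \<in> C
   \<or> (\<exists>i. 0 < i \<and> Suc i < length ps \<and> ps ! i \<in> Pa (ps ! Suc i) \<and> ps ! i \<in> C)
   \<or> (\<exists>i. 0 < i \<and> Suc i < length ps \<and> ps ! (i - 1) \<in> Pa (ps ! i) \<and> ps ! Suc i \<in> Pa (ps ! i)
         \<and> ps ! i \<notin> C \<and> desc G Pa (ps ! i) \<inter> C = {})
   \<or> last ps \<in> C"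

definition AD_separated :: "'n set \<Rightarrow> ('n \<Rightarrow> 'n set) \<Rightarrow> 'n set \<Rightarrow> 'n set \<Rightarrow> 'n set \<Rightarrow> bool" where
  "AD_separated G Pa I S C \<longleftrightarrow>
     (\<forall>ps. is_path G Pa ps \<longrightarrow> hd ps \<in> I \<longrightarrow> last ps \<in> S \<longrightarrow> blocked G Pa C ps)"

end

theory Submission
  imports Defs
begin

text \<open>
  Let \<open>K\<close> consist of the ancestors of \<open>I \<union> S \<union> C\<close> (inclusive) and let \<open>R\<close> be the part of \<open>K\<close> reachable from \<open>I\<close>
  by moving from any node to a parent, or from a node outside \<open>C\<close> to a child in \<open>K\<close>. AD-separation keeps
  \<open>S\<close> out of \<open>R\<close>; the set \<open>R\<close> is ancestral and feeds \<open>K - R\<close> only through \<open>C\<close>.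

  Given \<open>P\<close> in the extension, conditioning on an event with \<open>R\<close>-part and \<open>(K - R)\<close>-part averages over the states
  of \<open>R\<close>, so some compatible state \<open>b\<close> of \<open>R\<close> does not increase the expectation. The conditional model
  given \<open>b\<close> is then transplanted: a new member \<open>P'\<close> of the extension uses fixed local models on \<open>R\<close> and
  on all nodes affected by a deviation from \<open>b\<close>, and \<open>P(\<cdot> | b)\<close> on the remaining nodes. As long as \<open>x\<^sub>C\<close>
  is kept, no node of \<open>K - R\<close> is affected, so \<open>P'\<close> gives \<open>X\<^sub>S\<close> the same conditional model whatever event
  on \<open>R\<close> is added to \<open>x\<^sub>C\<close>. Hence the two infima bound each other.

  Conditioning on null events is handled by writing full conditional probabilities as limits of
  conditionals of strictly positive weights; for positive weights the construction is a plain product.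
\<close>

section \<open>Full conditional probabilities\<close>

lemma full_cond_probD:
  assumes P: "full_cond_prob \<Omega> Pr" and B: "B \<subseteq> \<Omega>" "B \<noteq> {}"
  shows full_cond_prob_nonneg: "A \<subseteq> \<Omega> \<Longrightarrow> 0 \<le> Pr A B"
    and full_cond_prob_space: "Pr \<Omega> B = 1"
    and full_cond_prob_Un: "A1 \<subseteq> \<Omega> \<Longrightarrow> A2 \<subseteq> \<Omega> \<Longrightarrow> A1 \<inter> A2 = {} \<Longrightarrow> Pr (A1 \<union> A2) B = Pr A1 B + Pr A2 B"
    and full_cond_prob_self: "Pr B B = 1"
    and full_cond_prob_chain: "A \<subseteq> \<Omega> \<Longrightarrow> C \<subseteq> \<Omega> \<Longrightarrow> C \<inter> B \<noteq> {} \<Longrightarrow> Pr (A \<inter> C) B = Pr A (C \<inter> B) * Pr C B"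
proof -
  note D = P[unfolded full_cond_prob_def]
  note F1 = D[THEN conjunct1, rule_format, OF B]
  show "A \<subseteq> \<Omega> \<Longrightarrow> 0 \<le> Pr A B" using F1[THEN conjunct1] by simp
  show "Pr \<Omega> B = 1" using F1[THEN conjunct2, THEN conjunct1] by simp
  show "A1 \<subseteq> \<Omega> \<Longrightarrow> A2 \<subseteq> \<Omega> \<Longrightarrow> A1 \<inter> A2 = {} \<Longrightarrow> Pr (A1 \<union> A2) B = Pr A1 B + Pr A2 B"
    by (rule F1[THEN conjunct2, THEN conjunct2, THEN conjunct1, rule_format])
  show "Pr B B = 1" using F1[THEN conjunct2, THEN conjunct2, THEN conjunct2] by simp
  show "A \<subseteq> \<Omega> \<Longrightarrow> C \<subseteq> \<Omega> \<Longrightarrow> C \<inter> B \<noteq> {} \<Longrightarrow> Pr (A \<inter> C) B = Pr A (C \<inter> B) * Pr C B"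
    by (rule D[THEN conjunct2, rule_format]) (use B in auto)
qed

lemma full_cond_prob_empty:
  assumes "full_cond_prob \<Omega> Pr" "B \<subseteq> \<Omega>" "B \<noteq> {}"
  shows "Pr {} B = 0"
  using full_cond_prob_Un[OF assms, of "{}" "{}"] by simp

lemma full_cond_prob_UN:
  assumes P: "full_cond_prob \<Omega> Pr" "B \<subseteq> \<Omega>" "B \<noteq> {}"
    and "finite J" "\<And>j. j \<in> J \<Longrightarrow> A j \<subseteq> \<Omega>" "disjoint_family_on A J"
  shows "Pr (\<Union>j\<in>J. A j) B = (\<Sum>j\<in>J. Pr (A j) B)"
  using assms(4-6)
proof (induction J)
  case empty
  show ?case using full_cond_prob_empty[OF P] by simp
next
  case (insert j J)
  have "A j \<inter> (\<Union>j\<in>J. A j) = {}"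
    using insert.hyps(2) insert.prems(2) unfolding disjoint_family_on_def by auto
  moreover have "disjoint_family_on A J"
    using insert.prems(2) unfolding disjoint_family_on_def by auto
  moreover have "(\<Union>j\<in>J. A j) \<subseteq> \<Omega>" using insert.prems(1) by (auto intro!: UN_least)
  ultimately show ?case
    using insert full_cond_prob_Un[OF P, of "A j" "\<Union>j\<in>J. A j"] by simp
qed

lemma full_cond_prob_Int:
  assumes P: "full_cond_prob \<Omega> Pr" "B \<subseteq> \<Omega>" "B \<noteq> {}" and "A \<subseteq> \<Omega>"
  shows "Pr (A \<inter> B) B = Pr A B"
  using full_cond_prob_chain[OF P, of A B] full_cond_prob_self[OF P] assms by simp

lemma full_cond_prob_total:
  assumes P: "full_cond_prob \<Omega> Pr" "B \<subseteq> \<Omega>" "B \<noteq> {}" and A: "A \<subseteq> \<Omega>" and fin: "finite \<Omega>"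
  shows "Pr A B = (\<Sum>k\<in>h ` B. Pr {z \<in> B. h z = k} B * Pr A {z \<in> B. h z = k})"
proof -
  have "A \<inter> B = (\<Union>k\<in>h ` B. A \<inter> {z \<in> B. h z = k})" by auto
  then have "Pr A B = Pr (\<Union>k\<in>h ` B. A \<inter> {z \<in> B. h z = k}) B"
    using full_cond_prob_Int[OF P A] by (metis (no_types, lifting))
  also have "\<dots> = (\<Sum>k\<in>h ` B. Pr (A \<inter> {z \<in> B. h z = k}) B)"
    by (rule full_cond_prob_UN[OF P])
      (use A finite_subset[OF P(2) fin] in \<open>auto simp: disjoint_family_on_def\<close>)
  also have "\<dots> = (\<Sum>k\<in>h ` B. Pr {z \<in> B. h z = k} B * Pr A {z \<in> B. h z = k})"
  proof (rule sum.cong[OF refl])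
    fix k assume "k \<in> h ` B"
    then have "{z \<in> B. h z = k} \<inter> B \<noteq> {}" by auto
    moreover have "{z \<in> B. h z = k} \<subseteq> \<Omega>" "{z \<in> B. h z = k} \<inter> B = {z \<in> B. h z = k}"
      using P(2) by auto
    ultimately show "Pr (A \<inter> {z \<in> B. h z = k}) B = Pr {z \<in> B. h z = k} B * Pr A {z \<in> B. h z = k}"
      using full_cond_prob_chain[OF P A, of "{z \<in> B. h z = k}"] by simp
  qed
  finally show ?thesis .
qed

lemma full_cond_prob_partition:
  assumes P: "full_cond_prob \<Omega> Pr" "B \<subseteq> \<Omega>" "B \<noteq> {}" and fin: "finite \<Omega>"
  shows "(\<Sum>k\<in>h ` B. Pr {z \<in> B. h z = k} B) = 1"
proof -
  have "Pr \<Omega> {z \<in> B. h z = k} = 1" if "k \<in> h ` B" for k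
    by (rule full_cond_prob_space[OF P(1)]) (use that P(2) in auto)
  then have "(\<Sum>k\<in>h ` B. Pr {z \<in> B. h z = k} B) =
      (\<Sum>k\<in>h ` B. Pr {z \<in> B. h z = k} B * Pr \<Omega> {z \<in> B. h z = k})"
    by (intro sum.cong) auto
  also have "\<dots> = Pr \<Omega> B" by (rule full_cond_prob_total[OF P order.refl fin, symmetric])
  also have "\<dots> = 1" by (rule full_cond_prob_space[OF P])
  finally show ?thesis .
qed

lemma full_cond_prob_sum_singletons:
  assumes P: "full_cond_prob \<Omega> Pr" "B \<subseteq> \<Omega>" "B \<noteq> {}" and "finite \<Omega>" "A \<subseteq> \<Omega>"
  shows "Pr A B = (\<Sum>x\<in>A. Pr {x} B)"
proof -
  have "Pr (\<Union>x\<in>A. {x}) B = (\<Sum>x\<in>A. Pr {x} B)"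
    by (rule full_cond_prob_UN[OF P])
      (use assms(5) finite_subset[OF assms(5,4)] in \<open>auto simp: disjoint_family_on_def\<close>)
  then show ?thesis by simp
qed

text \<open>The weights live on layers: the support of \<open>Pr (\<cdot> | \<Omega>)\<close> gets weight of order one, its
  complement is handled recursively and scaled down so that it vanishes in the limit.\<close>

lemma full_cond_prob_approx:
  assumes P: "full_cond_prob \<Omega> Pr" and fin: "finite \<Omega>"
  shows "\<exists>p :: nat \<Rightarrow> 'a \<Rightarrow> real. (\<forall>n. \<forall>x\<in>\<Omega>. 0 < p n x) \<and>
    (\<forall>A B. A \<subseteq> \<Omega> \<longrightarrow> B \<subseteq> \<Omega> \<longrightarrow> B \<noteq> {} \<longrightarrow> (\<lambda>n. sum (p n) (A \<inter> B) / sum (p n) B) \<longlonglongrightarrow> Pr A B)"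
proof -
  have "\<exists>p :: nat \<Rightarrow> 'a \<Rightarrow> real. (\<forall>n. \<forall>x\<in>\<Theta>. 0 < p n x) \<and>
      (\<forall>A B. A \<subseteq> \<Omega> \<longrightarrow> B \<subseteq> \<Theta> \<longrightarrow> B \<noteq> {} \<longrightarrow> (\<lambda>n. sum (p n) (A \<inter> B) / sum (p n) B) \<longlonglongrightarrow> Pr A B)"
    if "\<Theta> \<subseteq> \<Omega>" for \<Theta>
    using finite_subset[OF that fin] that
  proof (induction \<Theta> rule: finite_psubset_induct)
    case (psubset \<Theta>)
    show ?case
    proof (cases "\<Theta> = {}")
      case False
      note P\<Theta> = P \<open>\<Theta> \<subseteq> \<Omega>\<close> False
      define Z where "Z = {x \<in> \<Theta>. Pr {x} \<Theta> \<noteq> 0}"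
      have "(\<Sum>x\<in>\<Theta>. Pr {x} \<Theta>) = 1"
        using full_cond_prob_sum_singletons[OF P\<Theta> fin psubset.prems] full_cond_prob_self[OF P\<Theta>] by metis
      then have "\<exists>x\<in>\<Theta>. Pr {x} \<Theta> \<noteq> 0" by (rule contrapos_pp) simp
      then have "Z \<noteq> {}" unfolding Z_def by auto
      then have "\<Theta> - Z \<subset> \<Theta>" unfolding Z_def by auto
      moreover have "\<Theta> - Z \<subseteq> \<Omega>" using psubset.prems by auto
      ultimately have "\<exists>q :: nat \<Rightarrow> 'a \<Rightarrow> real. (\<forall>n. \<forall>x\<in>\<Theta> - Z. 0 < q n x) \<and> (\<forall>A B. A \<subseteq> \<Omega> \<longrightarrow> B \<subseteq> \<Theta> - Z \<longrightarrow> B \<noteq> {} \<longrightarrow>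
          (\<lambda>n. sum (q n) (A \<inter> B) / sum (q n) B) \<longlonglongrightarrow> Pr A B)"
        by (rule psubset.IH)
      then obtain q :: "nat \<Rightarrow> 'a \<Rightarrow> real" where q: "\<forall>n. \<forall>x\<in>\<Theta> - Z. 0 < q n x"
        and qlim: "\<forall>A B. A \<subseteq> \<Omega> \<longrightarrow> B \<subseteq> \<Theta> - Z \<longrightarrow> B \<noteq> {} \<longrightarrow> (\<lambda>n. sum (q n) (A \<inter> B) / sum (q n) B) \<longlonglongrightarrow> Pr A B"
        by (elim exE conjE)
      note q = q[rule_format] and qlim = qlim[rule_format]
      \<comment> \<open>Dividing by the total mass of \<open>q n\<close> keeps the lower layer under
        control however fast \<open>q n\<close> grows: \<open>\<delta> n * q n x\<close> is at most
        1/(n+1). The summand 1 keeps the denominator positive when \<open>\<Theta> - Z\<close> is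
        empty.\<close>
      define \<delta> where "\<delta> n = 1 / (real (Suc n) * (1 + sum (q n) (\<Theta> - Z)))" for n
      have sq: "0 \<le> sum (q n) (\<Theta> - Z)" for n using q by (intro sum_nonneg less_imp_le) auto
      have \<delta>: "0 < \<delta> n" for n unfolding \<delta>_def using sq[of n] by (auto intro!: divide_pos_pos mult_pos_pos)
      define p where "p n x = (if x \<in> Z then Pr {x} \<Theta> else \<delta> n * q n x)" for n x
      have "0 < p n x" if "x \<in> \<Theta>" for n x
      proof (cases "x \<in> Z")
        case True
        then show ?thesis using full_cond_prob_nonneg[OF P\<Theta>, of "{x}"] psubset.prems
          unfolding p_def Z_def by force
      next
        case False
        then show ?thesis using \<delta> q that unfolding p_def by simp
      qed
      moreover
      have plim: "(\<lambda>n. p n x) \<longlonglongrightarrow> Pr {x} \<Theta>" if x: "x \<in> \<Theta>" for x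
      proof (cases "x \<in> Z")
        case True
        then show ?thesis unfolding p_def by simp
      next
        case False
        have "\<delta> n * q n x \<le> 1 / real (Suc n)" for n
        proof -
          have "q n x \<le> sum (q n) (\<Theta> - Z)"
            using False x q psubset.hyps by (intro member_le_sum) (auto intro!: less_imp_le)
          then have "q n x / (1 + sum (q n) (\<Theta> - Z)) \<le> 1" using sq[of n] by simp
          then have "q n x / (1 + sum (q n) (\<Theta> - Z)) / real (Suc n) \<le> 1 / real (Suc n)"
            by (intro divide_right_mono) auto
          then show ?thesis unfolding \<delta>_def by (simp add: field_simps)
        qed
        moreover have "0 \<le> \<delta> n * q n x" for n using False x q \<delta> by (simp add: less_imp_le)
        ultimately have "(\<lambda>n. \<delta> n * q n x) \<longlonglongrightarrow> 0"
          using tendsto_sandwich[of "\<lambda>_. 0" "\<lambda>n. \<delta> n * q n x" sequentially "\<lambda>n. 1 / real (Suc n)" 0]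
          LIMSEQ_Suc[OF lim_1_over_n] by simp
        then show ?thesis using False x unfolding p_def Z_def by simp
      qed
      have "(\<lambda>n. sum (p n) (A \<inter> B) / sum (p n) B) \<longlonglongrightarrow> Pr A B" 
        if AB: "A \<subseteq> \<Omega>" "B \<subseteq> \<Theta>" "B \<noteq> {}" for A B
      \<comment> \<open>If \<open>B\<close> misses the top layer, the factor
        \<open>\<delta> n\<close> cancels in the quotient and the recursively built weights decide.
        Otherwise \<open>B\<close> has positive probability given \<open>\<Theta>\<close>, and (F2)
        expresses \<open>Pr A B\<close> as a quotient of probabilities given
        \<open>\<Theta>\<close>.\<close>
      proof (cases "B \<inter> Z = {}")
        case True
        have "sum (p n) C = \<delta> n * sum (q n) C" if "C \<subseteq> B" for C n
          unfolding sum_distrib_left using that True by (intro sum.cong) (auto simp: p_def)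
        then have "sum (p n) (A \<inter> B) / sum (p n) B = sum (q n) (A \<inter> B) / sum (q n) B" for n
          using \<delta>[of n] by simp
        then show ?thesis using qlim[of A B] AB True by (simp add: Diff_eq disjoint_eq_subset_Compl)
      next
        case False
        then obtain x where x: "x \<in> B" "Pr {x} \<Theta> \<noteq> 0" unfolding Z_def by auto
        have B: "B \<subseteq> \<Omega>" "B \<inter> \<Theta> = B" "x \<in> \<Omega>" using x AB psubset.prems by auto
        have lim: "(\<lambda>n. sum (p n) C) \<longlonglongrightarrow> Pr C \<Theta>" if "C \<subseteq> \<Theta>" for C
          using full_cond_prob_sum_singletons[OF P\<Theta> fin, of C] plim that psubset.prems
          by (auto intro!: tendsto_sum)
        have "Pr {x} \<Theta> \<le> Pr B \<Theta>"
          using full_cond_prob_Un[OF P\<Theta>, of "{x}" "B - {x}"] full_cond_prob_nonneg[OF P\<Theta>, of "B - {x}"] x B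
          by (simp add: insert_absorb Diff_subset_conv subset_insertI2)
        then have "Pr B \<Theta> \<noteq> 0"
          using x B full_cond_prob_nonneg[OF P\<Theta>, of "{x}"] by auto
        moreover have "Pr (A \<inter> B) \<Theta> = Pr A B * Pr B \<Theta>"
          using full_cond_prob_chain[OF P\<Theta>, of A B] AB B by simp
        ultimately show ?thesis
          using tendsto_divide[OF lim[of "A \<inter> B"] lim[of B]] AB by (simp add: le_infI2)
      qed
      ultimately show ?thesis by blast
    qed auto
  qed
  from this[OF order.refl] show ?thesis .
qed

section \<open>Limits of conditionals along a common subsequence\<close>

lemma common_convergent_subsequence:
  fixes f :: "'i \<Rightarrow> nat \<Rightarrow> real"
  assumes "finite J" "\<And>j. j \<in> J \<Longrightarrow> bounded (range (f j))"
  obtains r :: "nat \<Rightarrow> nat" where "strict_mono r" "\<And>j. j \<in> J \<Longrightarrow> convergent (f j \<circ> r)"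
proof -
  have "\<exists>r :: nat \<Rightarrow> nat. strict_mono r \<and> (\<forall>j\<in>J. convergent (f j \<circ> r))"
    using assms
  proof (induction J)
    case empty
    show ?case using strict_mono_id by blast
  next
    case (insert j J)
    then obtain r :: "nat \<Rightarrow> nat" where r: "strict_mono r" "\<forall>j\<in>J. convergent (f j \<circ> r)"
      by (metis insertI2)
    have "bounded (range (f j \<circ> r))"
      using insert.prems[of j] by (auto intro: bounded_subset)
    then obtain l r' where r': "strict_mono r'" "((f j \<circ> r) \<circ> r') \<longlonglongrightarrow> l"
      using bounded_imp_convergent_subsequence by blast
    have "convergent (f i \<circ> (r \<circ> r'))" if "i \<in> insert j J" for i
    proof (cases "i = j")
      case True
      then show ?thesis using r'(2) unfolding convergent_def by (auto simp: o_assoc)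
    next
      case False
      then have "convergent ((f i \<circ> r) \<circ> r')"
        using that r(2) r'(1) by (intro convergent_subseq_convergent[of "f i \<circ> r"]) auto
      then show ?thesis by (simp add: o_assoc)
    qed
    then show ?case using strict_mono_o[OF r(1) r'(1)] by blast
  qed
  then show ?thesis using that by blast
qed

text \<open>For positive weights, (F1) and (F2) are exact properties of quotients, and they survive
  limits. There are finitely many pairs of events and the quotients lie in [0,1], so one subsequence
  makes all of them converge. It is part of the conclusion because other sequences must later be
  followed along the same indices.\<close>

lemma full_cond_prob_limit:
  fixes w :: "nat \<Rightarrow> 'a \<Rightarrow> real"
  assumes fin: "finite \<Omega>" and pos: "\<And>n x. x \<in> \<Omega> \<Longrightarrow> 0 < w n x"
  shows "\<exists>Pr r. full_cond_prob \<Omega> Pr \<and> strict_mono (r :: nat \<Rightarrow> nat) \<and>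
    (\<forall>A B. A \<subseteq> \<Omega> \<longrightarrow> B \<subseteq> \<Omega> \<longrightarrow> B \<noteq> {} \<longrightarrow>
       (\<lambda>n. sum (w (r n)) (A \<inter> B) / sum (w (r n)) B) \<longlonglongrightarrow> Pr A B)"
proof -
  define g where "g = (\<lambda>(A, B) n. sum (w n) (A \<inter> B) / sum (w n) B)"
  have nn: "0 \<le> sum (w n) A" if "A \<subseteq> \<Omega>" for n A
    using that pos by (intro sum_nonneg less_imp_le) auto
  have sp: "0 < sum (w n) A" if "A \<subseteq> \<Omega>" "A \<noteq> {}" for n A
    using that pos finite_subset[OF that(1) fin] by (intro sum_pos) auto
  have g: "0 \<le> g (A, B) n" "g (A, B) n \<le> 1" if "A \<subseteq> \<Omega>" "B \<subseteq> \<Omega>" for A B n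
  proof -
    show "0 \<le> g (A, B) n" unfolding g_def using that nn[of "A \<inter> B" n] nn[of B n] by (simp add: le_infI1)
    have "sum (w n) (A \<inter> B) \<le> sum (w n) B"
      using that pos finite_subset[OF that(2) fin] by (intro sum_mono2) (auto intro!: less_imp_le)
    then show "g (A, B) n \<le> 1" unfolding g_def using that nn[of B n] by (auto simp: divide_le_eq_1)
  qed
  have "bounded (range (g AB))" if "AB \<in> Pow \<Omega> \<times> Pow \<Omega>" for AB
  proof (rule boundedI[where B = 1])
    fix y assume "y \<in> range (g AB)"
    then obtain n where "y = g (fst AB, snd AB) n" by auto
    then show "norm y \<le> 1" using g[of "fst AB" "snd AB" n] that by auto
  qed
  then obtain r :: "nat \<Rightarrow> nat" where r: "strict_mono r"
    and conv: "\<And>AB. AB \<in> Pow \<Omega> \<times> Pow \<Omega> \<Longrightarrow> convergent (g AB \<circ> r)"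
    using common_convergent_subsequence[of "Pow \<Omega> \<times> Pow \<Omega>" g] fin by (metis finite_Pow_iff finite_cartesian_product)
  define Pr where "Pr A B = lim (g (A, B) \<circ> r)" for A B
  have lim: "(\<lambda>n. g (A, B) (r n)) \<longlonglongrightarrow> Pr A B" if "A \<subseteq> \<Omega>" "B \<subseteq> \<Omega>" for A B
    using conv[of "(A, B)"] that convergent_LIMSEQ_iff[of "g (A, B) \<circ> r"] unfolding Pr_def o_def by auto
  have "full_cond_prob \<Omega> Pr"
    unfolding full_cond_prob_def
  proof (intro conjI allI impI)
    fix A B :: "'a set" assume "B \<subseteq> \<Omega>" "B \<noteq> {}" "A \<subseteq> \<Omega>"
    then show "0 \<le> Pr A B" using lim[of A B] g by (intro LIMSEQ_le_const) auto
  next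
    fix B assume B: "B \<subseteq> \<Omega>" "B \<noteq> {}"
    then have "sum (w n) B \<noteq> 0" "\<Omega> \<inter> B = B" for n using sp[OF B, of n] by auto
    then have "g (\<Omega>, B) n = 1" "g (B, B) n = 1" for n unfolding g_def by auto
    then show "Pr \<Omega> B = 1" "Pr B B = 1" using lim[of \<Omega> B] lim[of B B] B by (simp_all add: LIMSEQ_const_iff)
  next
    fix B A1 A2 assume A: "B \<subseteq> \<Omega>" "B \<noteq> {}" "A1 \<subseteq> \<Omega>" "A2 \<subseteq> \<Omega>" "A1 \<inter> A2 = {}"
    have "sum (w n) ((A1 \<union> A2) \<inter> B) = sum (w n) (A1 \<inter> B) + sum (w n) (A2 \<inter> B)" for n
      unfolding Int_Un_distrib2 using A finite_subset[OF A(1) fin] by (intro sum.union_disjoint) auto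
    then have "g (A1 \<union> A2, B) n = g (A1, B) n + g (A2, B) n" for n
      unfolding g_def by (simp add: add_divide_distrib)
    then have "(\<lambda>n. g (A1 \<union> A2, B) (r n)) \<longlonglongrightarrow> Pr A1 B + Pr A2 B"
      using tendsto_add[OF lim[of A1 B] lim[of A2 B]] A by simp
    then show "Pr (A1 \<union> A2) B = Pr A1 B + Pr A2 B"
      using lim[of "A1 \<union> A2" B] A by (auto intro: LIMSEQ_unique)
  next
    fix A B C assume A: "A \<subseteq> \<Omega>" "B \<subseteq> \<Omega>" "C \<subseteq> \<Omega>" "C \<inter> B \<noteq> {}"
    have "C \<inter> B \<subseteq> \<Omega>" using A by auto
    then have "sum (w n) (C \<inter> B) \<noteq> 0" for n using sp[of "C \<inter> B" n] A(4) by simp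
    then have "g (A \<inter> C, B) n = g (A, C \<inter> B) n * g (C, B) n" for n
      unfolding g_def by (simp add: Int_assoc)
    moreover have "C \<inter> B \<subseteq> \<Omega>" "A \<inter> C \<subseteq> \<Omega>" using A by auto
    ultimately show "Pr (A \<inter> C) B = Pr A (C \<inter> B) * Pr C B"
      using tendsto_mult[OF lim[of A "C \<inter> B"] lim[of C B]] lim[of "A \<inter> C" B] A
      by (auto intro: LIMSEQ_unique)
  qed
  then show ?thesis using r lim unfolding g_def by (intro exI[of _ Pr] exI[of _ r]) simp
qed

section \<open>Averages and convex combinations\<close>

lemma full_cond_prob_le_1:
  assumes P: "full_cond_prob \<Omega> Pr" "B \<subseteq> \<Omega>" "B \<noteq> {}" and A: "A \<subseteq> \<Omega>"
  shows "Pr A B \<le> 1"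
proof -
  have "Pr (A \<union> (\<Omega> - A)) B = Pr A B + Pr (\<Omega> - A) B"
    by (rule full_cond_prob_Un[OF P]) (use A in auto)
  moreover have "A \<union> (\<Omega> - A) = \<Omega>" using A by auto
  moreover have "0 \<le> Pr (\<Omega> - A) B" by (rule full_cond_prob_nonneg[OF P]) auto
  ultimately show ?thesis using full_cond_prob_space[OF P] by simp
qed

text \<open>If every value exceeded the average, the weighted deviations from it would be
  nonnegative with sum 0, which forces every weight to vanish.\<close>

lemma weighted_average_ge_some:
  fixes a e :: "'k \<Rightarrow> real"
  assumes J: "finite J" and a: "\<And>k. k \<in> J \<Longrightarrow> 0 \<le> a k" "sum a J = 1"
  shows "\<exists>k\<in>J. e k \<le> (\<Sum>k\<in>J. a k * e k)"
proof (rule ccontr)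
  let ?E = "\<Sum>k\<in>J. a k * e k"
  assume "\<not> ?thesis"
  then have less: "?E < e k" if "k \<in> J" for k using that by auto
  have "(\<Sum>k\<in>J. a k * (e k - ?E)) = ?E - sum a J * ?E"
    by (simp add: right_diff_distrib sum_subtractf sum_distrib_right)
  then have "(\<Sum>k\<in>J. a k * (e k - ?E)) = 0" using a(2) by simp
  then have "\<forall>k\<in>J. a k * (e k - ?E) = 0"
    using J a(1) less by (subst (asm) sum_nonneg_eq_0_iff) (auto intro!: mult_nonneg_nonneg simp: less_imp_le)
  then have "\<forall>k\<in>J. a k = 0" using less by force
  then show False using a(2) by simp
qed

text \<open>By total probability, the expectation given \<open>B\<close> is an average of the
  expectations given the level sets of \<open>h\<close> in \<open>B\<close>. The level set is named
  by a point \<open>b\<close> of \<open>B\<close>; with \<open>h\<close> the restriction to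
  \<open>R\<close>, this point becomes the reference state.\<close>

lemma full_cond_prob_expectation_ge_some:
  fixes f :: "'j \<Rightarrow> real"
  assumes P: "full_cond_prob \<Omega> Pr" "B \<subseteq> \<Omega>" "B \<noteq> {}" and fin: "finite \<Omega>"
    and A: "\<And>j. j \<in> J \<Longrightarrow> A j \<subseteq> \<Omega>"
  shows "\<exists>b\<in>B. (\<Sum>j\<in>J. f j * Pr (A j) {z \<in> B. h z = h b}) \<le> (\<Sum>j\<in>J. f j * Pr (A j) B)"
proof -
  let ?B = "\<lambda>k. {z \<in> B. h z = k}"
  have "(\<Sum>j\<in>J. f j * Pr (A j) B) = (\<Sum>j\<in>J. \<Sum>k\<in>h ` B. Pr (?B k) B * (f j * Pr (A j) (?B k)))"
  proof (rule sum.cong[OF refl])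
    fix j assume "j \<in> J"
    show "f j * Pr (A j) B = (\<Sum>k\<in>h ` B. Pr (?B k) B * (f j * Pr (A j) (?B k)))"
      by (subst full_cond_prob_total[OF P A[OF \<open>j \<in> J\<close>] fin, of h]) (simp add: sum_distrib_left mult_ac)
  qed
  also have "\<dots> = (\<Sum>k\<in>h ` B. Pr (?B k) B * (\<Sum>j\<in>J. f j * Pr (A j) (?B k)))"
    by (subst sum.swap) (simp add: sum_distrib_left)
  finally have eq: "(\<Sum>j\<in>J. f j * Pr (A j) B) = (\<Sum>k\<in>h ` B. Pr (?B k) B * (\<Sum>j\<in>J. f j * Pr (A j) (?B k)))" .
  have "\<exists>k\<in>h ` B. (\<Sum>j\<in>J. f j * Pr (A j) (?B k)) \<le> (\<Sum>k\<in>h ` B. Pr (?B k) B * (\<Sum>j\<in>J. f j * Pr (A j) (?B k)))"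
  proof (rule weighted_average_ge_some)
    show "finite (h ` B)" using finite_subset[OF P(2) fin] by simp
    show "0 \<le> Pr (?B k) B" for k by (rule full_cond_prob_nonneg[OF P]) (use P(2) in auto)
    show "(\<Sum>k\<in>h ` B. Pr (?B k) B) = 1" by (rule full_cond_prob_partition[OF P fin])
  qed
  then show ?thesis unfolding eq by blast
qed

lemma convex_fun_set_sum:
  assumes K: "convex_fun_set K"
  shows "finite J \<Longrightarrow> (\<And>j. j \<in> J \<Longrightarrow> 0 \<le> a j) \<Longrightarrow> sum a J = 1 \<Longrightarrow> (\<And>j. j \<in> J \<Longrightarrow> q j \<in> K) \<Longrightarrow>
    (\<lambda>v. \<Sum>j\<in>J. a j * q j v) \<in> K"
proof (induction J arbitrary: a rule: finite_induct)
  case empty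
  then show ?case by simp
next
  case (insert j J)
  show ?case
  \<comment> \<open>The remaining weights are renormalized by \<open>1 - a j\<close>, so the
    degenerate case, where they all vanish, is treated separately.\<close>
  proof (cases "a j = 1")
    case True
    then have "sum a J = 0" using insert.prems(2) insert.hyps by simp
    then have "\<forall>i\<in>J. a i = 0"
      using insert.hyps insert.prems(1) by (subst (asm) sum_nonneg_eq_0_iff) auto
    then have "(\<lambda>v. \<Sum>i\<in>insert j J. a i * q i v) = q j"
      using insert.hyps True by (simp add: fun_eq_iff)
    then show ?thesis using insert.prems(3) by simp
  next
    case False
    have sum: "sum a J = 1 - a j" using insert.prems(2) insert.hyps by simp
    moreover have "0 \<le> sum a J" by (rule sum_nonneg) (use insert.prems(1) in auto)
    ultimately have j: "a j < 1" using False by simp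
    have "(\<lambda>v. \<Sum>i\<in>J. a i / (1 - a j) * q i v) \<in> K"
    proof (rule insert.IH)
      show "0 \<le> a i / (1 - a j)" if "i \<in> J" for i using insert.prems(1)[of i] that j by simp
      show "(\<Sum>i\<in>J. a i / (1 - a j)) = 1" using sum j by (simp add: sum_divide_distrib[symmetric])
      show "q i \<in> K" if "i \<in> J" for i using insert.prems(3) that by simp
    qed
    then have "(\<lambda>v. a j * q j v + (1 - a j) * (\<Sum>i\<in>J. a i / (1 - a j) * q i v)) \<in> K"
      using K[unfolded convex_fun_set_def, rule_format, OF insert.prems(3)[of j]] insert.prems(1)[of j] j by simp
    moreover have "(1 - a j) * (\<Sum>i\<in>J. a i / (1 - a j) * q i v) = (\<Sum>i\<in>J. a i * q i v)" for v
      using j by (simp add: sum_distrib_left)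
    ultimately show ?thesis using insert.hyps by simp
  qed
qed

section \<open>Ancestral sets and AD-separation\<close>

definition ancestral :: "('n \<Rightarrow> 'n set) \<Rightarrow> 'n set \<Rightarrow> bool" where
  "ancestral Pa A \<longleftrightarrow> (\<forall>v\<in>A. Pa v \<subseteq> A)"

text \<open>A finite acyclic edge relation is well-founded, and a minimal node of
  \<open>G - A\<close> will do. This lets an ancestral set grow to \<open>G\<close> one node at a
  time.\<close>

lemma ancestral_insert_exists:
  assumes dag: "is_dag G Pa" and A: "A \<subset> G"
  obtains a where "a \<in> G - A" "Pa a \<subseteq> A"
proof -
  have edgeG: "edges G Pa \<subseteq> G \<times> G" using dag unfolding edges_def is_dag_def by auto
  then have "finite (edges G Pa)" using dag finite_subset unfolding is_dag_def by blast
  then have "wf (edges G Pa)"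
    using dag unfolding is_dag_def by (simp add: finite_acyclic_wf)
  moreover obtain x where "x \<in> G - A" using A by blast
  ultimately obtain a where a: "a \<in> G - A" "\<And>y. (y, a) \<in> edges G Pa \<Longrightarrow> y \<notin> G - A"
    by (rule wfE_min) auto
  have "Pa a \<subseteq> A"
  proof
    fix y assume "y \<in> Pa a"
    then have "(y, a) \<in> edges G Pa" using a(1) unfolding edges_def by auto
    then show "y \<in> A" using a(2) edgeG by auto
  qed
  then show ?thesis using a(1) that by blast
qed

lemma ancestral_edges:
  assumes "ancestral Pa A" "v \<in> A" "(u, v) \<in> (edges G Pa)\<^sup>*"
  shows "u \<in> A"
  using assms(3,2)
proof (induction rule: converse_rtrancl_induct)
  case (step y z)
  then show ?case using assms(1) unfolding ancestral_def edges_def by auto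
qed

text \<open>The local condition at \<open>s\<close> concerns the joint of \<open>s\<close> and its
  nondescendants given the latter, so both node sets must admit the marginal formula for ancestral
  sets. Acyclicity keeps parents of \<open>s\<close> out of its descendants, and a child of
  \<open>s\<close> or of a descendant of \<open>s\<close> is again a descendant.\<close>

lemma ancestral_nondesc:
  assumes dag: "is_dag G Pa" and s: "s \<in> G"
  shows "ancestral Pa (nondesc G Pa s)" "ancestral Pa (insert s (nondesc G Pa s))"
    "Pa s \<subseteq> nondesc G Pa s" "nondesc G Pa s \<subseteq> G" "s \<notin> nondesc G Pa s"
proof -
  have G: "Pa v \<subseteq> G" if "v \<in> G" for v using dag that unfolding is_dag_def by auto
  show *: "Pa s \<subseteq> nondesc G Pa s"
  proof
    fix u assume u: "u \<in> Pa s"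
    then have "(u, s) \<in> (edges G Pa)\<^sup>+" using s unfolding edges_def by auto
    moreover from this have "(s, u) \<notin> (edges G Pa)\<^sup>+" "u \<noteq> s"
      using dag unfolding is_dag_def acyclic_def by (metis trancl_trans)+
    ultimately show "u \<in> nondesc G Pa s" using u G s unfolding nondesc_def desc_def by auto
  qed
  show N: "ancestral Pa (nondesc G Pa s)"
    unfolding ancestral_def
  proof (intro ballI subsetI)
    fix v u assume v: "v \<in> nondesc G Pa s" and u: "u \<in> Pa v"
    then have uv: "(u, v) \<in> edges G Pa" unfolding edges_def nondesc_def by auto
    have "u \<noteq> s" using v uv unfolding nondesc_def desc_def by auto
    moreover have "(s, u) \<notin> (edges G Pa)\<^sup>+"
      using v uv unfolding nondesc_def desc_def by (auto dest: trancl_into_trancl)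
    moreover have "u \<in> G" using G u v unfolding nondesc_def by auto
    ultimately show "u \<in> nondesc G Pa s" unfolding nondesc_def desc_def by auto
  qed
  show "ancestral Pa (insert s (nondesc G Pa s))"
    using N * unfolding ancestral_def by auto
qed (auto simp: nondesc_def)

text \<open>Only (B2) and (B3) are negated. The endpoint is left free, so that a path may stop in
  \<open>C\<close> and still be extended; (B1) and (B4) are excluded at the end by disjointness of
  \<open>C\<close> from \<open>I\<close> and \<open>S\<close>.\<close>

definition open_path :: "'n set \<Rightarrow> ('n \<Rightarrow> 'n set) \<Rightarrow> 'n set \<Rightarrow> 'n set \<Rightarrow> 'n list \<Rightarrow> bool" where
  "open_path G Pa C I ps \<longleftrightarrow> is_path G Pa ps \<and> hd ps \<in> I \<and>
     (\<forall>i. 0 < i \<longrightarrow> Suc i < length ps \<longrightarrow>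
        \<not> (ps ! i \<in> Pa (ps ! Suc i) \<and> ps ! i \<in> C) \<and>
        \<not> (ps ! (i - 1) \<in> Pa (ps ! i) \<and> ps ! Suc i \<in> Pa (ps ! i) \<and> ps ! i \<notin> C \<and> desc G Pa (ps ! i) \<inter> C = {}))"

lemma open_path_single: "v \<in> I \<Longrightarrow> v \<in> G \<Longrightarrow> open_path G Pa C I [v]"
  unfolding open_path_def is_path_def by simp

text \<open>The old endpoint is the only node that can become interior, so (B2) and (B3) need
  checking there alone. A one-node path has no predecessor at its end, hence the length
  guard.\<close>

lemma open_path_snoc:
  assumes ps: "open_path G Pa C I ps" and w: "w \<in> G" "last ps \<in> Pa w \<or> w \<in> Pa (last ps)"
    and B2: "last ps \<in> Pa w \<Longrightarrow> last ps \<notin> C"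
    and B3: "2 \<le> length ps \<Longrightarrow> ps ! (length ps - 2) \<in> Pa (last ps) \<Longrightarrow> w \<in> Pa (last ps) \<Longrightarrow>
         last ps \<in> C \<or> desc G Pa (last ps) \<inter> C \<noteq> {}"
  shows "open_path G Pa C I (ps @ [w])"
proof -
  have ne: "ps \<noteq> []" using ps unfolding open_path_def is_path_def by simp
  have l: "last ps = ps ! (length ps - 1)" using ne by (rule last_conv_nth)
  have "(ps @ [w]) ! i \<in> Pa ((ps @ [w]) ! Suc i) \<or> (ps @ [w]) ! Suc i \<in> Pa ((ps @ [w]) ! i)"
    if "Suc i < length (ps @ [w])" for i
  proof (cases "Suc i < length ps")
    case True
    then show ?thesis using ps unfolding open_path_def is_path_def by (simp add: nth_append)
  next
    case False
    then have "length ps - 1 = i" "i < length ps" "Suc i = length ps" using that by auto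
    then show ?thesis using w l by (auto simp: nth_append)
  qed
  then have "is_path G Pa (ps @ [w])"
    using ps w unfolding open_path_def is_path_def by simp
  moreover have "hd (ps @ [w]) \<in> I" using ps ne unfolding open_path_def by simp
  moreover have "\<not> ((ps @ [w]) ! i \<in> Pa ((ps @ [w]) ! Suc i) \<and> (ps @ [w]) ! i \<in> C) \<and>
        \<not> ((ps @ [w]) ! (i - 1) \<in> Pa ((ps @ [w]) ! i) \<and> (ps @ [w]) ! Suc i \<in> Pa ((ps @ [w]) ! i)
           \<and> (ps @ [w]) ! i \<notin> C \<and> desc G Pa ((ps @ [w]) ! i) \<inter> C = {})"
    if i: "0 < i" "Suc i < length (ps @ [w])" for i
  proof (cases "Suc i < length ps")
    case True
    moreover from this have "i - 1 < length ps" by simp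
    ultimately show ?thesis using ps i unfolding open_path_def by (simp add: nth_append)
  next
    case False
    then have "Suc i = length ps" using i by simp
    moreover from this have "i < length ps" "i - 1 < length ps" "length ps - 1 = i" "length ps - 2 = i - 1"
      "2 \<le> length ps" using i by auto
    ultimately show ?thesis using B2 B3 l by (auto simp: nth_append)
  qed
  ultimately show ?thesis unfolding open_path_def by blast
qed

lemma dag_asym:
  assumes "is_dag G Pa" "u \<in> Pa v" "v \<in> G" "u \<in> G" shows "v \<notin> Pa u"
proof
  assume "v \<in> Pa u"
  then have "(u, v) \<in> edges G Pa" "(v, u) \<in> edges G Pa" using assms unfolding edges_def by auto
  then show False using assms(1) unfolding is_dag_def acyclic_def by (meson trancl.intros)
qed

text \<open>All nodes on the way down from \<open>v\<close> lie outside \<open>C\<close>, which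
  rules out (B2), and a node left towards a child is not a collider.\<close>

lemma open_path_descend:
  assumes dag: "is_dag G Pa" and ps: "open_path G Pa C I ps" "last ps = v"
    and C: "v \<notin> C" "desc G Pa v \<inter> C = {}" and vw: "(v, w) \<in> (edges G Pa)\<^sup>*"
  shows "\<exists>qs. open_path G Pa C I qs \<and> last qs = w"
  using vw
proof (induction rule: rtrancl_induct)
  case base
  show ?case using ps by blast
next
  case (step y z)
  then obtain qs where qs: "open_path G Pa C I qs" "last qs = y" by blast
  have "y \<notin> C" using step(1) C unfolding desc_def by (auto simp: rtrancl_eq_or_trancl)
  have yz: "y \<in> Pa z" "z \<in> G" "y \<in> G" using step(2) dag unfolding edges_def is_dag_def by auto
  have "open_path G Pa C I (qs @ [z])"
    using qs yz \<open>y \<notin> C\<close> dag_asym[OF dag yz] by (intro open_path_snoc) auto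
  then show ?case by (metis last_snoc)
qed

text \<open>The last conjunct records that \<open>v\<close> is either the start or was entered from
  a child. Hence \<open>v\<close> is no collider when the path continues to a parent of
  \<open>v\<close>.\<close>

lemma open_path_ascend:
  assumes dag: "is_dag G Pa" and i: "i \<in> I" "i \<in> G" and vi: "(v, i) \<in> (edges G Pa)\<^sup>*"
  shows "\<exists>qs. open_path G Pa C I qs \<and> last qs = v \<and> (2 \<le> length qs \<longrightarrow> qs ! (length qs - 2) \<notin> Pa v)"
  using vi
proof (induction rule: converse_rtrancl_induct)
  case base
  show ?case using open_path_single[OF i] by (intro exI[of _ "[i]"]) auto
next
  case (step y z)
  then obtain qs where qs: "open_path G Pa C I qs" "last qs = z"
    "2 \<le> length qs \<longrightarrow> qs ! (length qs - 2) \<notin> Pa z" by blast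
  have yz: "y \<in> Pa z" "z \<in> G" "y \<in> G" using step(1) dag unfolding edges_def is_dag_def by auto
  have ne: "qs \<noteq> []" using qs unfolding open_path_def is_path_def by auto
  have "open_path G Pa C I (qs @ [y])"
    using qs yz dag_asym[OF dag yz] by (intro open_path_snoc) auto
  moreover have "(qs @ [y]) ! (length (qs @ [y]) - 2) = z"
    using ne qs(2) by (simp add: nth_append last_conv_nth)
  ultimately show ?case using dag_asym[OF dag yz] by (intro exI[of _ "qs @ [y]"]) simp
qed

text \<open>Every node reachable by the moves \<open>mv\<close> is the end of an open path from
  \<open>I\<close>, so a node of \<open>S\<close> in \<open>R\<close> would contradict separation.
  The difficulty is that \<open>mv\<close> forgets how a node was entered, while (B3) depends on
  it.\<close>

lemma AD_separated_split:
  assumes dag: "is_dag G Pa" and subs: "I \<subseteq> G" "S \<subseteq> G" "C \<subseteq> G"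
    and disj: "I \<inter> C = {}" "S \<inter> C = {}" and sep: "AD_separated G Pa I S C"
  obtains R K where "R \<subseteq> K" "K \<subseteq> G" "ancestral Pa R" "ancestral Pa K" "I \<subseteq> R" "S \<subseteq> K - R" "C \<subseteq> K"
    "\<forall>t\<in>K - R. Pa t \<inter> R \<subseteq> C"
proof -
  define K where "K = {v. \<exists>w \<in> I \<union> S \<union> C. (v, w) \<in> (edges G Pa)\<^sup>*}"
  define mv where "mv = {(u, v). u \<in> K \<and> v \<in> K \<and> (u \<notin> C \<and> u \<in> Pa v \<or> v \<in> Pa u)}"
  define R where "R = mv\<^sup>* `` I"
  have edgeG: "u \<in> G" "v \<in> G" if "(u, v) \<in> edges G Pa" for u v
    using that dag unfolding edges_def is_dag_def by auto
  have KG: "K \<subseteq> G" unfolding K_def using subs edgeG by (auto elim: converse_rtranclE)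
  have ISC: "I \<union> S \<union> C \<subseteq> K" unfolding K_def by auto
  have K: "ancestral Pa K"
    unfolding ancestral_def
  proof (intro ballI subsetI)
    fix v u assume "v \<in> K" "u \<in> Pa v"
    moreover from this have "(u, v) \<in> edges G Pa" using KG unfolding edges_def by auto
    ultimately show "u \<in> K" unfolding K_def by (auto intro: converse_rtrancl_into_rtrancl)
  qed
  have RK: "R \<subseteq> K" unfolding R_def mv_def using ISC by (auto elim: rtranclE)
  have R: "ancestral Pa R"
    unfolding ancestral_def
  proof (intro ballI subsetI)
    fix v u assume "v \<in> R" "u \<in> Pa v"
    moreover from this have "(v, u) \<in> mv" using RK K unfolding ancestral_def mv_def by auto
    ultimately show "u \<in> R" unfolding R_def by (auto intro: rtrancl_into_rtrancl)
  qed
  have no_open: False if "open_path G Pa C I ps" "last ps \<in> S" for ps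
  proof -
    have "blocked G Pa C ps" using that sep unfolding AD_separated_def open_path_def by blast
    moreover have "hd ps \<notin> C" "last ps \<notin> C" using that disj unfolding open_path_def by auto
    ultimately show False using that(1) unfolding blocked_def open_path_def by blast
  qed
  have reach: "\<exists>ps. open_path G Pa C I ps \<and> last ps = v" if "i \<in> I" "(i, v) \<in> mv\<^sup>*" for i v
    using that(2)
  proof (induction rule: rtrancl_induct)
    case base
    show ?case using open_path_single[of i I G] that subs by (intro exI[of _ "[i]"]) auto
  next
    case (step v w)
    then obtain ps where ps: "open_path G Pa C I ps" "last ps = v" by blast
    have vw: "v \<in> K" "v \<in> G" "w \<in> G" "v \<notin> C \<and> v \<in> Pa w \<or> w \<in> Pa v"
      using step(2) KG unfolding mv_def by auto
    consider (forward) "v \<notin> C" "v \<in> Pa w" | (free) "w \<in> Pa v" "v \<in> C \<or> desc G Pa v \<inter> C \<noteq> {}"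
      | (collider) "w \<in> Pa v" "v \<notin> C" "desc G Pa v \<inter> C = {}" using vw by blast
    then show ?case
    proof cases
      case forward
      then have "open_path G Pa C I (ps @ [w])"
        using ps vw dag_asym[OF dag forward(2)] by (intro open_path_snoc) auto
      then show ?thesis by (metis last_snoc)
    next
      case free
      then have "open_path G Pa C I (ps @ [w])"
        using ps vw dag_asym[OF dag free(1)] by (intro open_path_snoc) auto
      then show ?thesis by (metis last_snoc)
    next
      case collider
      \<comment> \<open>Going on to a parent could create a blocked collider at \<open>v\<close>. As
        a member of \<open>K\<close>, \<open>v\<close> leads down to \<open>I\<close>,
        \<open>S\<close> or \<open>C\<close>. By assumption this is not \<open>C\<close>; a descent
        to \<open>S\<close> would complete an unblocked path. So \<open>v\<close> is an ancestor of
        \<open>I\<close> or in \<open>I\<close>, and the path is replaced by one ascending from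
        there.\<close>
      obtain y where y: "y \<in> I \<union> S \<union> C" "(v, y) \<in> (edges G Pa)\<^sup>*" using vw(1) unfolding K_def by auto
      moreover have "y \<notin> C" using y(2) collider unfolding desc_def by (auto simp: rtrancl_eq_or_trancl)
      moreover have "y \<notin> S"
        using open_path_descend[OF dag ps collider(2,3) y(2)] no_open by blast
      ultimately have "y \<in> I" by blast
      then obtain qs where "open_path G Pa C I qs" "last qs = v"
          "2 \<le> length qs \<longrightarrow> qs ! (length qs - 2) \<notin> Pa v"
        using open_path_ascend[OF dag _ _ y(2)] subs by blast
      then have "open_path G Pa C I (qs @ [w])"
        using vw dag_asym[OF dag collider(1)] collider by (intro open_path_snoc) auto
      then show ?thesis by (metis last_snoc)
    qed
  qed
  then have "S \<inter> R = {}" using no_open unfolding R_def by blast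
  moreover have "Pa t \<inter> R \<subseteq> C" if "t \<in> K - R" for t
  proof
    fix u assume u: "u \<in> Pa t \<inter> R"
    show "u \<in> C"
    proof (rule ccontr)
      assume "u \<notin> C"
      then have "(u, t) \<in> mv" using that u RK unfolding mv_def by auto
      then have "t \<in> R" using u unfolding R_def by (auto intro: rtrancl_into_rtrancl)
      then show False using that by auto
    qed
  qed
  moreover have "I \<subseteq> R" unfolding R_def by auto
  ultimately show ?thesis using that[of R K] RK KG R K ISC by blast
qed

section \<open>Transplanting a conditional model\<close>

text \<open>The nodes of \<open>- R\<close> whose kernel must not be copied from the reference state \<open>b\<close>, because a
  deviation of \<open>x\<close> from \<open>b\<close> on \<open>R\<close> propagates to them outside \<open>R\<close>.\<close>

definition touched :: "'n set \<Rightarrow> ('n \<Rightarrow> 'n set) \<Rightarrow> 'n set \<Rightarrow> ('n \<Rightarrow> 'v) \<Rightarrow> ('n \<Rightarrow> 'v) \<Rightarrow> 'n set" where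
  "touched G Pa R b x = {t. \<exists>r\<in>R. x r \<noteq> b r \<and> (r, t) \<in> (edges G Pa \<inter> UNIV \<times> (- R))\<^sup>+}"

text \<open>The source of any deviation that reaches an ancestral set lies in that set. So
  coordinates outside \<open>A\<close> do not influence which nodes of \<open>A\<close> are
  touched.\<close>

lemma touched_cong:
  assumes "ancestral Pa A" "\<And>r. r \<in> A \<inter> R \<Longrightarrow> x r = y r"
  shows "A \<inter> touched G Pa R b x = A \<inter> touched G Pa R b y"
proof -
  have "A \<inter> touched G Pa R b x \<subseteq> touched G Pa R b y"
    if "\<And>r. r \<in> A \<inter> R \<Longrightarrow> x r = y r" for x y
  proof
    fix t assume "t \<in> A \<inter> touched G Pa R b x"
    then obtain r where r: "t \<in> A" "r \<in> R" "x r \<noteq> b r" "(r, t) \<in> (edges G Pa \<inter> UNIV \<times> (- R))\<^sup>+"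
      unfolding touched_def by auto
    have "(r, t) \<in> (edges G Pa)\<^sup>*" using r(4) by (meson inf_le1 trancl_into_rtrancl trancl_mono)
    then have "r \<in> A" using ancestral_edges[OF assms(1) r(1)] by blast
    then show "t \<in> touched G Pa R b y" using r that[of r] unfolding touched_def by auto
  qed
  from this[of x y] this[of y x] assms(2) show ?thesis by auto
qed

text \<open>Consequently, fixing \<open>b\<close> on \<open>R\<close> and \<open>x\<close> on the
  untouched nodes outside \<open>R\<close> puts the parents of an untouched node in their state
  under \<open>x\<close>.\<close>

lemma untouched_parents:
  assumes "t \<notin> R" "t \<notin> touched G Pa R b x" "t \<in> G" "u \<in> Pa t"
  shows "u \<in> R \<Longrightarrow> x u = b u" "u \<notin> R \<Longrightarrow> u \<notin> touched G Pa R b x"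
proof -
  have e: "(u, t) \<in> edges G Pa \<inter> UNIV \<times> (- R)" using assms unfolding edges_def by auto
  show "u \<in> R \<Longrightarrow> x u = b u" using e assms(2) unfolding touched_def by auto
  show "u \<notin> R \<Longrightarrow> u \<notin> touched G Pa R b x"
    using e assms(2) unfolding touched_def by (auto intro: trancl_into_trancl)
qed

text \<open>A deviation entering \<open>K\<close> makes its first step from a node of
  \<open>R\<close> to a node of \<open>K - R\<close>. That first node must lie in \<open>C\<close>,
  where \<open>x\<close> and \<open>b\<close> agree.\<close>

lemma touched_empty:
  assumes K: "ancestral Pa K" and C: "\<forall>t\<in>K - R. Pa t \<inter> R \<subseteq> C"
    and b: "\<forall>c\<in>C \<inter> R. x c = b c"
  shows "K \<inter> touched G Pa R b x = {}"
proof -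
  have False if tr: "t \<in> K" "r \<in> R" "x r \<noteq> b r" "(r, t) \<in> (edges G Pa \<inter> UNIV \<times> (- R))\<^sup>+" for t r
  proof -
    obtain u where u: "(r, u) \<in> edges G Pa \<inter> UNIV \<times> (- R)" "(u, t) \<in> (edges G Pa \<inter> UNIV \<times> (- R))\<^sup>*"
      using tranclD[OF tr(4)] by blast
    have "(u, t) \<in> (edges G Pa)\<^sup>*" using u(2) by (meson inf_le1 rtrancl_mono subsetD)
    then have "u \<in> K - R" using ancestral_edges[OF K tr(1)] u(1) by auto
    then have "r \<in> C" using C u(1) tr(2) unfolding edges_def by auto
    then show False using b tr by auto
  qed
  then show ?thesis unfolding touched_def by blast
qed

text \<open>Events are predicates on total functions, so the same predicate can be read on
  \<open>PiE A Xs\<close> for different \<open>A\<close>; this notion says when that is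
  harmless.\<close>

definition depends_on :: "'n set \<Rightarrow> (('n \<Rightarrow> 'v) \<Rightarrow> 'c) \<Rightarrow> bool" where
  "depends_on A g \<longleftrightarrow> (\<forall>x y. (\<forall>t\<in>A. x t = y t) \<longrightarrow> g x = g y)"

lemma depends_onD: "depends_on A g \<Longrightarrow> (\<And>t. t \<in> A \<Longrightarrow> x t = y t) \<Longrightarrow> g x = g y"
  unfolding depends_on_def by blast

lemma depends_on_mono: "depends_on A g \<Longrightarrow> A \<subseteq> B \<Longrightarrow> depends_on B g"
  unfolding depends_on_def by blast

lemma depends_on_conj:
  assumes "depends_on A P" "depends_on A Q" shows "depends_on A (\<lambda>x. P x \<and> Q x)"
  using assms unfolding depends_on_def by metis

lemma depends_on_restrict: "S \<subseteq> A \<Longrightarrow> depends_on A (\<lambda>x. P (restrict x S))"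
  unfolding depends_on_def
proof (intro allI impI)
  fix x y :: "'a \<Rightarrow> 'b" assume "S \<subseteq> A" "\<forall>t\<in>A. x t = y t"
  then have "restrict x S = restrict y S" by (intro restrict_ext) auto
  then show "P (restrict x S) = P (restrict y S)" by simp
qed

lemma depends_on_if: "depends_on A Q \<Longrightarrow> depends_on A (\<lambda>x. if Q x then c else d)"
  unfolding depends_on_def by metis

lemma depends_on_agree: "S \<subseteq> A \<Longrightarrow> depends_on A (\<lambda>z. \<forall>t\<in>S. z t = x t)"
  unfolding depends_on_def by (metis subsetD)

definition agree :: "('n \<Rightarrow> 'v) set \<Rightarrow> 'n set \<Rightarrow> ('n \<Rightarrow> 'v) \<Rightarrow> 'n set \<Rightarrow> ('n \<Rightarrow> 'v) \<Rightarrow> ('n \<Rightarrow> 'v) set" where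
  "agree \<Omega> R b U x = {z \<in> \<Omega>. (\<forall>r\<in>R. z r = b r) \<and> (\<forall>t\<in>U. z t = x t)}"

section \<open>Positive weights glued from local kernels and a joint conditioned on
  \<open>b\<close>\<close>

locale glued_weights =
  fixes G :: "'n set" and Pa :: "'n \<Rightarrow> 'n set" and Xs :: "'n \<Rightarrow> 'v set"
    and R :: "'n set" and b :: "'n \<Rightarrow> 'v"
    and \<kappa> :: "'n \<Rightarrow> ('n \<Rightarrow> 'v) \<Rightarrow> 'v \<Rightarrow> real" and p :: "('n \<Rightarrow> 'v) \<Rightarrow> real"
  assumes dag: "is_dag G Pa" and fin: "\<And>s. s \<in> G \<Longrightarrow> finite (Xs s)"
    and R: "R \<subseteq> G" "ancestral Pa R" and b: "b \<in> PiE G Xs"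
    and \<kappa>_pos: "\<And>s x v. s \<in> G \<Longrightarrow> x \<in> PiE (Pa s) Xs \<Longrightarrow> v \<in> Xs s \<Longrightarrow> 0 < \<kappa> s x v"
    and \<kappa>_sum: "\<And>s x. s \<in> G \<Longrightarrow> x \<in> PiE (Pa s) Xs \<Longrightarrow> (\<Sum>v\<in>Xs s. \<kappa> s x v) = 1"
    and p_pos: "\<And>z. z \<in> PiE G Xs \<Longrightarrow> 0 < p z"
begin

abbreviation "tch x \<equiv> touched G Pa R b x"

text \<open>Untouched nodes outside \<open>R\<close> follow the joint \<open>p\<close> given \<open>b\<close> on \<open>R\<close>; all other nodes follow
  the local kernels. For ancestral \<open>A\<close> these weights are consistent under marginalization.\<close>

definition W :: "'n set \<Rightarrow> ('n \<Rightarrow> 'v) \<Rightarrow> real" where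
  "W A x = (\<Prod>s\<in>A \<inter> (R \<union> tch x). \<kappa> s (restrict x (Pa s)) (x s)) *
           sum p (agree (PiE G Xs) R b (A - R - tch x) x)"

lemma finite_G: "finite G" using dag unfolding is_dag_def by auto

lemma finite_states: "A \<subseteq> G \<Longrightarrow> finite (PiE A Xs)"
  using finite_subset[OF _ finite_G] fin by (intro finite_PiE) auto

text \<open>Adding one node to an ancestral set either multiplies by one kernel value or refines the
  event measured by \<open>p\<close>.\<close>

lemma W_fun_upd:
  assumes A: "A \<subseteq> G" "ancestral Pa A" and a: "a \<in> G - A" "Pa a \<subseteq> A"
  shows "W (insert a A) (x(a := v)) =
    (if a \<in> R \<union> tch x then \<kappa> a (restrict x (Pa a)) v * W A x
     else (\<Prod>s\<in>A \<inter> (R \<union> tch x). \<kappa> s (restrict x (Pa s)) (x s)) *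
       sum p {z \<in> agree (PiE G Xs) R b (A - R - tch x) x. z a = v})"
proof -
  let ?y = "x(a := v)"
  have insA: "ancestral Pa (insert a A)" using A a unfolding ancestral_def by auto
  have 1: "A \<inter> tch ?y = A \<inter> tch x" by (rule touched_cong) (use A a in auto)
  \<comment> \<open>The value at \<open>a\<close> can matter for being touched only if
    \<open>a\<close> lies in \<open>R\<close>, and then \<open>a\<close> uses its kernel anyway. So
    the choice between kernel and joint does not depend on \<open>v\<close>.\<close>
  have 2: "a \<in> tch ?y \<longleftrightarrow> a \<in> tch x" if "a \<notin> R"
  proof -
    have "insert a A \<inter> tch ?y = insert a A \<inter> tch x" by (rule touched_cong[OF insA]) (use that in auto)
    then show ?thesis by blast
  qed
  have 3: "a \<in> R \<union> tch ?y \<longleftrightarrow> a \<in> R \<union> tch x" using 2 by auto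
  have Ai: "A \<inter> (R \<union> tch ?y) = A \<inter> (R \<union> tch x)" "A - R - tch ?y = A - R - tch x" using 1 by auto
  have k: "restrict ?y (Pa s) = restrict x (Pa s)" "s \<noteq> a" if "s \<in> A" for s
    using A a that unfolding ancestral_def by (auto simp: fun_eq_iff restrict_def)
  have ka: "restrict ?y (Pa a) = restrict x (Pa a)" using a by (auto simp: fun_eq_iff restrict_def)
  have prod: "(\<Prod>s\<in>A \<inter> (R \<union> tch x). \<kappa> s (restrict ?y (Pa s)) (?y s)) =
      (\<Prod>s\<in>A \<inter> (R \<union> tch x). \<kappa> s (restrict x (Pa s)) (x s))"
    by (rule prod.cong) (use k in auto)
  have ag: "agree (PiE G Xs) R b (A - R - tch x) ?y = agree (PiE G Xs) R b (A - R - tch x) x"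
    using a unfolding agree_def by auto
  have finA: "finite (A \<inter> (R \<union> tch x))" using finite_subset[OF A(1) finite_G] by auto
  show ?thesis
  proof (cases "a \<in> R \<union> tch x")
    case True
    then have "insert a A \<inter> (R \<union> tch ?y) = insert a (A \<inter> (R \<union> tch x))" "insert a A - R - tch ?y = A - R - tch x"
      using 1 3 by auto
    then show ?thesis unfolding W_def using True ag prod ka a finA by (simp add: mult.assoc)
  next
    case False
    then have "insert a A \<inter> (R \<union> tch ?y) = A \<inter> (R \<union> tch x)" "insert a A - R - tch ?y = insert a (A - R - tch x)"
      using 1 3 by auto
    moreover have "agree (PiE G Xs) R b (insert a (A - R - tch x)) ?y
        = {z \<in> agree (PiE G Xs) R b (A - R - tch x) x. z a = v}"
      using a unfolding agree_def by auto
    ultimately show ?thesis unfolding W_def using False prod by simp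
  qed
qed

text \<open>A kernel has total mass 1; in the other case the events fixing the value at
  \<open>a\<close> partition the event measured by \<open>p\<close>.\<close>

lemma W_sum_out:
  assumes A: "A \<subseteq> G" "ancestral Pa A" and a: "a \<in> G - A" "Pa a \<subseteq> A" and x: "x \<in> PiE A Xs"
  shows "(\<Sum>v\<in>Xs a. W (insert a A) (x(a := v))) = W A x"
proof (cases "a \<in> R \<union> tch x")
  case True
  have "restrict x (Pa a) \<in> PiE (Pa a) Xs" using x a by auto
  then show ?thesis
    using True a \<kappa>_sum[of a "restrict x (Pa a)"] by (simp add: W_fun_upd[OF A a] sum_distrib_right[symmetric])
next
  case False
  let ?g = "agree (PiE G Xs) R b (A - R - tch x) x"
  have "finite ?g" using finite_states[OF order.refl] unfolding agree_def by auto
  moreover have "(\<lambda>z. z a) ` ?g \<subseteq> Xs a" using a unfolding agree_def by auto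
  ultimately have "(\<Sum>v\<in>Xs a. sum p {z \<in> ?g. z a = v}) = sum p ?g"
    using sum.group[of ?g "Xs a" "\<lambda>z. z a" p] fin a by simp
  then show ?thesis using False W_fun_upd[OF A a, of x] unfolding W_def[of A x]
    by (simp add: sum_distrib_left[symmetric])
qed

lemma sum_PiE_insert:
  fixes g :: "('n \<Rightarrow> 'v) \<Rightarrow> real"
  assumes "a \<notin> A"
  shows "(\<Sum>y\<in>PiE (insert a A) Xs. g y) = (\<Sum>x\<in>PiE A Xs. \<Sum>v\<in>Xs a. g (x(a := v)))"
proof -
  have "(\<Sum>y\<in>PiE (insert a A) Xs. g y) = (\<Sum>(v, x)\<in>Xs a \<times> PiE A Xs. g (x(a := v)))"
    unfolding PiE_insert_eq
    by (subst sum.reindex[OF inj_combinator[OF assms]]) (simp add: o_def case_prod_beta)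
  also have "\<dots> = (\<Sum>x\<in>PiE A Xs. \<Sum>v\<in>Xs a. g (x(a := v)))"
    by (simp add: sum.cartesian_product[symmetric] sum.swap[of _ "PiE A Xs"])
  finally show ?thesis .
qed

text \<open>Nodes outside \<open>A\<close> are summed out in reverse topological order: the
  induction adds to \<open>A\<close> a node whose parents are already there.\<close>

lemma W_marginal:
  fixes g :: "('n \<Rightarrow> 'v) \<Rightarrow> real"
  assumes "A \<subseteq> G" "ancestral Pa A" and "depends_on A g"
  shows "(\<Sum>x\<in>PiE G Xs. g x * W G x) = (\<Sum>x\<in>PiE A Xs. g x * W A x)"
  using assms
proof (induction "card (G - A)" arbitrary: A)
  case 0
  then have "A = G" using finite_G by auto
  then show ?case by simp
next
  case (Suc n)
  have "A \<noteq> G" using Suc.hyps(2) by auto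
  then obtain a where a: "a \<in> G - A" "Pa a \<subseteq> A"
    using ancestral_insert_exists[OF dag, of A] Suc.prems(1) by blast
  have g: "g (x(a := v)) = g x" for x v
    by (rule depends_onD[OF Suc.prems(3)]) (use a in auto)
  have "G - insert a A = (G - A) - {a}" by auto
  then have n: "n = card (G - insert a A)" using Suc.hyps(2) a finite_G by simp
  have ins: "insert a A \<subseteq> G" "ancestral Pa (insert a A)"
    using Suc.prems(1,2) a unfolding ancestral_def by auto
  have cong: "depends_on (insert a A) g" using depends_on_mono[OF Suc.prems(3)] by blast
  have "(\<Sum>x\<in>PiE G Xs. g x * W G x) = (\<Sum>x\<in>PiE (insert a A) Xs. g x * W (insert a A) x)"
    by (rule Suc.hyps(1)[OF n ins cong])
  also have "\<dots> = (\<Sum>x\<in>PiE A Xs. \<Sum>v\<in>Xs a. g x * W (insert a A) (x(a := v)))"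
    using a by (subst sum_PiE_insert) (auto simp: g)
  also have "\<dots> = (\<Sum>x\<in>PiE A Xs. g x * W A x)"
    using W_sum_out[OF Suc.prems(1,2) a] by (intro sum.cong) (simp_all add: sum_distrib_left[symmetric])
  finally show ?case .
qed

lemma W_pos:
  assumes A: "A \<subseteq> G" "ancestral Pa A" and x: "x \<in> PiE A Xs"
  shows "0 < W A x"
proof -
  have "(\<lambda>t. if t \<in> R then b t else if t \<in> A then x t else b t) \<in> agree (PiE G Xs) R b (A - R - tch x) x"
    using x b A unfolding agree_def by (auto simp: PiE_iff extensional_def)
  moreover have "finite (agree (PiE G Xs) R b (A - R - tch x) x)"
    using finite_states[OF order.refl] unfolding agree_def by auto
  ultimately have "0 < sum p (agree (PiE G Xs) R b (A - R - tch x) x)"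
    using p_pos by (intro sum_pos) (auto simp: agree_def)
  moreover have "0 < \<kappa> s (restrict x (Pa s)) (x s)" if "s \<in> A" for s
    using A x that by (intro \<kappa>_pos) (auto simp: ancestral_def)
  ultimately show ?thesis unfolding W_def by (intro mult_pos_pos prod_pos) auto
qed

lemma W_event:
  assumes A: "A \<subseteq> G" "ancestral Pa A" and Q: "depends_on A Q"
  shows "sum (W G) {x \<in> PiE G Xs. Q x} = sum (W A) {x \<in> PiE A Xs. Q x}"
proof -
  have "(\<Sum>x\<in>PiE G Xs. (if Q x then 1 else 0) * W G x) = (\<Sum>x\<in>PiE A Xs. (if Q x then 1 else 0) * W A x)"
    by (rule W_marginal[OF A]) (rule depends_on_if[OF Q])
  moreover have "(\<Sum>x\<in>PiE B Xs. (if Q x then 1 else 0) * W B x) = sum (W B) {x \<in> PiE B Xs. Q x}" if "B \<subseteq> G" for B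
    using finite_states[OF that] by (simp add: if_distrib[of "\<lambda>c. c * _"] sum.inter_filter cong: if_cong)
  ultimately show ?thesis using A by simp
qed

text \<open>Both events are decided by ancestral sets, \<open>N\<close> and \<open>N\<close> with
  \<open>s\<close> added, on which each consists of a single state. The quotient of the two weights
  is then read off from \<open>W_fun_upd\<close>.\<close>

lemma W_local:
  assumes s: "s \<in> G" and x: "x \<in> PiE (nondesc G Pa s) Xs" and v: "v \<in> Xs s"
  defines "N \<equiv> nondesc G Pa s"
  defines "B \<equiv> agree (PiE G Xs) R b (N - R - tch x) x"
  shows "sum (W G) {z \<in> PiE G Xs. z s = v \<and> (\<forall>t\<in>N. z t = x t)} / sum (W G) {z \<in> PiE G Xs. \<forall>t\<in>N. z t = x t}
    = (if s \<in> R \<union> tch x then \<kappa> s (restrict x (Pa s)) v else sum p ({z \<in> PiE G Xs. z s = v} \<inter> B) / sum p B)"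
proof -
  note N = ancestral_nondesc[OF dag s, folded N_def]
  have x': "x \<in> PiE N Xs" using x N_def by simp
  have "{z \<in> PiE N Xs. \<forall>t\<in>N. z t = x t} = {x}"
    using x' by (auto intro: PiE_ext)
  moreover have "sum (W G) {z \<in> PiE G Xs. \<forall>t\<in>N. z t = x t} = sum (W N) {z \<in> PiE N Xs. \<forall>t\<in>N. z t = x t}"
    by (rule W_event[OF N(4,1)]) (rule depends_on_agree[OF order.refl])
  ultimately have 1: "sum (W G) {z \<in> PiE G Xs. \<forall>t\<in>N. z t = x t} = W N x" by simp
  have "{z \<in> PiE (insert s N) Xs. z s = v \<and> (\<forall>t\<in>N. z t = x t)} = {x(s := v)}"
  proof (intro equalityI subsetI)
    fix z assume "z \<in> {z \<in> PiE (insert s N) Xs. z s = v \<and> (\<forall>t\<in>N. z t = x t)}"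
    then have z: "z \<in> PiE (insert s N) Xs" "z s = v" "\<And>t. t \<in> N \<Longrightarrow> z t = x t" by auto
    have "z t = (x(s := v)) t" for t
      using z PiE_arb[OF z(1), of t] PiE_arb[OF x', of t] by (cases "t = s"; cases "t \<in> N") simp_all
    then show "z \<in> {x(s := v)}" by auto
  qed (use x' v N in \<open>auto simp: PiE_iff extensional_def\<close>)
  moreover have "sum (W G) {z \<in> PiE G Xs. z s = v \<and> (\<forall>t\<in>N. z t = x t)} =
     sum (W (insert s N)) {z \<in> PiE (insert s N) Xs. z s = v \<and> (\<forall>t\<in>N. z t = x t)}"
    by (rule W_event) (use N s in \<open>auto intro: depends_on_conj depends_on_agree simp: depends_on_def\<close>)
  ultimately have 2: "sum (W G) {z \<in> PiE G Xs. z s = v \<and> (\<forall>t\<in>N. z t = x t)} = W (insert s N) (x(s := v))" by simp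
  have "W N x \<noteq> 0" using W_pos[OF N(4,1) x'] by simp
  moreover have "{z \<in> B. z s = v} = {z \<in> PiE G Xs. z s = v} \<inter> B" unfolding B_def agree_def by auto
  ultimately show ?thesis
    unfolding 1 2 using W_fun_upd[OF N(4,1) _ N(3), of x v] s N(5)
    by (auto simp: W_def B_def)
qed

text \<open>With \<open>K\<close> untouched, the kernels act exactly on \<open>R\<close> and
  \<open>p\<close> exactly on \<open>K - R\<close>, so the weight factorizes. The factor over
  \<open>R\<close> does not involve \<open>Q2\<close> and will cancel in conditional
  probabilities.\<close>

lemma W_untouched_event:
  assumes K: "K \<subseteq> G" "ancestral Pa K" "R \<subseteq> K"
    and Q1: "depends_on R Q1" and Q2: "depends_on (K - R) Q2"
    and unt: "\<forall>x. Q1 x \<longrightarrow> K \<inter> tch x = {}"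
  shows "sum (W G) {x \<in> PiE G Xs. Q1 x \<and> Q2 x} =
     (\<Sum>x\<in>{x \<in> PiE R Xs. Q1 x}. \<Prod>s\<in>R. \<kappa> s (restrict x (Pa s)) (x s)) *
     sum p {z \<in> PiE G Xs. (\<forall>r\<in>R. z r = b r) \<and> Q2 z}"
proof -
  let ?k = "\<lambda>x. \<Prod>s\<in>R. \<kappa> s (restrict x (Pa s)) (x s)"
  let ?Z = "{z \<in> PiE G Xs. \<forall>r\<in>R. z r = b r}"
  let ?X = "{x \<in> PiE K Xs. Q1 x}"
  have fin: "finite ?Z" "finite ?X" "finite {x \<in> PiE R Xs. Q1 x}" using finite_states[OF order.refl] finite_states[OF K(1)] finite_states[OF R(1)] by auto
  have Q2': "Q2 z = Q2 x" if "\<forall>t\<in>K - R. z t = x t" for x z using depends_onD[OF Q2] that by blast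
  have "sum (W G) {x \<in> PiE G Xs. Q1 x \<and> Q2 x} = sum (W K) {x \<in> PiE K Xs. Q1 x \<and> Q2 x}"
    using K by (intro W_event depends_on_conj depends_on_mono[OF Q1] depends_on_mono[OF Q2]) auto
  also have "\<dots> = (\<Sum>x\<in>?X. if Q2 x then W K x else 0)"
    using fin by (simp add: sum.inter_filter[symmetric] conj_ac)
  also have "\<dots> = (\<Sum>x\<in>?X. \<Sum>z\<in>?Z. if Q2 z \<and> (\<forall>t\<in>K - R. z t = x t) then ?k x * p z else 0)"
  proof (rule sum.cong[OF refl])
    fix x assume x: "x \<in> ?X"
    have "K \<inter> (R \<union> tch x) = R" "K - R - tch x = K - R" using unt x K(3) by auto
    then have "W K x = ?k x * sum p {z \<in> ?Z. \<forall>t\<in>K - R. z t = x t}"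
      unfolding W_def agree_def by (simp add: conj_ac)
    also have "\<dots> = (\<Sum>z\<in>?Z. if \<forall>t\<in>K - R. z t = x t then ?k x * p z else 0)"
      unfolding sum_distrib_left by (rule sum.inter_filter[OF fin(1)])
    finally have "W K x = (\<Sum>z\<in>?Z. if \<forall>t\<in>K - R. z t = x t then ?k x * p z else 0)" .
    moreover have "(if Q2 z \<and> (\<forall>t\<in>K - R. z t = x t) then ?k x * p z else 0)
       = (if Q2 x then (if \<forall>t\<in>K - R. z t = x t then ?k x * p z else 0) else 0)" for z
      using Q2'[of z x] by auto
    ultimately show "(if Q2 x then W K x else 0) =
        (\<Sum>z\<in>?Z. if Q2 z \<and> (\<forall>t\<in>K - R. z t = x t) then ?k x * p z else 0)" by simp
  qed
  also have "\<dots> = (\<Sum>z\<in>?Z. \<Sum>x\<in>?X. if Q2 z \<and> (\<forall>t\<in>K - R. z t = x t) then ?k x * p z else 0)"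
    by (rule sum.swap)
  also have "\<dots> = (\<Sum>z\<in>?Z. if Q2 z then sum ?k {x \<in> PiE R Xs. Q1 x} * p z else 0)"
  proof (rule sum.cong[OF refl])
    fix z assume z: "z \<in> ?Z"
    have "sum ?k {x \<in> ?X. \<forall>t\<in>K - R. z t = x t} = sum ?k {x \<in> PiE R Xs. Q1 x}"
    \<comment> \<open>For fixed \<open>z\<close>, a state of \<open>K\<close> that matches
      \<open>z\<close> on \<open>K - R\<close> is determined by its part on
      \<open>R\<close>.\<close>
    proof (rule sum.reindex_bij_witness[where i = "\<lambda>y t. if t \<in> R then y t else if t \<in> K then z t else undefined"
          and j = "\<lambda>x. restrict x R"])
      fix x assume x: "x \<in> {x \<in> ?X. \<forall>t\<in>K - R. z t = x t}"
      show "(\<lambda>t. if t \<in> R then restrict x R t else if t \<in> K then z t else undefined) = x"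
      proof
        fix t show "(if t \<in> R then restrict x R t else if t \<in> K then z t else undefined) = x t"
          using x PiE_arb[of x K Xs t] by auto
      qed
      show "restrict x R \<in> {x \<in> PiE R Xs. Q1 x}"
      proof -
        have "Q1 x = Q1 (restrict x R)" by (rule depends_onD[OF Q1]) simp
        then show ?thesis using x K(3) by auto
      qed
      show "(\<Prod>s\<in>R. \<kappa> s (restrict (restrict x R) (Pa s)) (restrict x R s)) = ?k x"
        using R(2) by (intro prod.cong) (auto simp: ancestral_def Int_absorb1)
    next
      fix y assume y: "y \<in> {x \<in> PiE R Xs. Q1 x}"
      let ?y = "\<lambda>t. if t \<in> R then y t else if t \<in> K then z t else undefined"
      show "restrict ?y R = y"
      proof
        fix t show "restrict ?y R t = y t" using y PiE_arb[of y R Xs t] by auto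
      qed
      have "Q1 ?y = Q1 y" by (rule depends_onD[OF Q1]) simp
      then show "?y \<in> {x \<in> ?X. \<forall>t\<in>K - R. z t = x t}"
        using y z K by (auto simp: PiE_iff extensional_def)
    qed
    then show "(\<Sum>x\<in>?X. if Q2 z \<and> (\<forall>t\<in>K - R. z t = x t) then ?k x * p z else 0) =
        (if Q2 z then sum ?k {x \<in> PiE R Xs. Q1 x} * p z else 0)"
      using sum.inter_filter[OF fin(2), of "\<lambda>x. ?k x * p z" "\<lambda>x. \<forall>t\<in>K - R. z t = x t"]
      by (simp add: sum_distrib_right[symmetric])
  qed
  also have "\<dots> = sum ?k {x \<in> PiE R Xs. Q1 x} * sum p {z \<in> ?Z. Q2 z}"
    unfolding sum_distrib_left by (rule sum.inter_filter[OF fin(1), symmetric])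
  finally show ?thesis by (simp add: conj_ac)
qed

end

text \<open>The extension constrains \<open>s\<close> only given a full state of its nondescendants.
  The event \<open>B\<close> is a union of such events, all with parent state \<open>y\<close>, so
  the conditional is a mixture of members of the convex set \<open>M s y\<close>.\<close>

lemma irr_ext_coarse:
  assumes dag: "is_dag G Pa" and fin: "\<And>s. s \<in> G \<Longrightarrow> finite (Xs s)"
    and Pr: "Pr \<in> irr_ext G Pa Xs M" and s: "s \<in> G" and conv: "convex_fun_set (M s y)"
    and B: "B = {z \<in> PiE G Xs. Q z}" "B \<noteq> {}"
    and Q: "depends_on (nondesc G Pa s) Q"
    and y: "\<And>z. z \<in> B \<Longrightarrow> restrict z (Pa s) = y"
  shows "(\<lambda>v. if v \<in> Xs s then Pr {z \<in> PiE G Xs. z s = v} B else 0) \<in> M s y"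
proof -
  let ?N = "nondesc G Pa s"
  let ?h = "\<lambda>z. restrict z ?N"
  let ?B = "\<lambda>k. {z \<in> B. ?h z = k}"
  note N = ancestral_nondesc[OF dag s]
  have P: "full_cond_prob (PiE G Xs) Pr" "B \<subseteq> PiE G Xs" "B \<noteq> {}" using Pr B unfolding irr_ext_def by auto
  have fin': "finite (PiE G Xs)" using dag fin unfolding is_dag_def by (auto intro: finite_PiE)
  have "(\<lambda>v. \<Sum>k\<in>?h ` B. Pr (?B k) B * (if v \<in> Xs s then Pr {z \<in> PiE G Xs. z s = v} (?B k) else 0)) \<in> M s y"
  proof (rule convex_fun_set_sum[OF conv])
    show "finite (?h ` B)" using finite_subset[OF P(2) fin'] by simp
    show "0 \<le> Pr (?B k) B" for k by (rule full_cond_prob_nonneg[OF P]) (use P(2) in auto)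
    show "(\<Sum>k\<in>?h ` B. Pr (?B k) B) = 1" by (rule full_cond_prob_partition[OF P fin'])
    fix k assume "k \<in> ?h ` B"
    then obtain z0 where z0: "z0 \<in> B" "k = ?h z0" by auto
    have Qz: "Q z" if "\<forall>t\<in>?N. z t = z0 t" for z
      using depends_onD[OF Q, of z z0] that z0 B(1) by auto
    have Bk: "?B k = {z \<in> PiE G Xs. \<forall>t\<in>?N. z t = k t}"
      using Qz unfolding z0(2) B(1) by (auto simp: fun_eq_iff restrict_def)
    have k: "k \<in> PiE ?N Xs" using z0 N(4) B(1) by auto
    have ky: "restrict k (Pa s) = y"
      using y[OF z0(1)] N(3) unfolding z0(2) by (simp add: Int_absorb1)
    have "\<forall>x\<in>PiE ?N Xs. (\<lambda>v. if v \<in> Xs s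
        then Pr {z \<in> PiE G Xs. z s = v} {z \<in> PiE G Xs. \<forall>t\<in>?N. z t = x t} else 0) \<in> M s (restrict x (Pa s))"
      using Pr s unfolding irr_ext_def by blast
    from bspec[OF this k]
    show "(\<lambda>v. if v \<in> Xs s then Pr {z \<in> PiE G Xs. z s = v} (?B k) else 0) \<in> M s y"
      unfolding Bk ky .
  qed
  moreover have "Pr {z \<in> PiE G Xs. z s = v} B = (\<Sum>k\<in>?h ` B. Pr (?B k) B * Pr {z \<in> PiE G Xs. z s = v} (?B k))" for v
    by (rule full_cond_prob_total[OF P _ fin']) auto
  then have "(\<lambda>v. \<Sum>k\<in>?h ` B. Pr (?B k) B * (if v \<in> Xs s then Pr {z \<in> PiE G Xs. z s = v} (?B k) else 0))
    = (\<lambda>v. if v \<in> Xs s then Pr {z \<in> PiE G Xs. z s = v} B else 0)" by (intro ext) simp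
  ultimately show ?thesis by simp
qed

text \<open>\<open>Pr'\<close> is a limit of glued weights. Each local conditional tends either to a
  chosen local model or to a conditional of \<open>Pr\<close> covered by
  \<open>irr_ext_coarse\<close>. The asserted equality holds for each approximating weight, after
  cancelling the factor over \<open>R\<close>, and passes to the limit.\<close>

lemma irr_ext_glue:
  fixes G :: "'n set" and Xs :: "'n \<Rightarrow> 'v set"
  assumes dag: "is_dag G Pa" and spaces: "\<forall>s\<in>G. finite (Xs s) \<and> Xs s \<noteq> {}"
    and models: "local_models_ok G Pa Xs M" and Pr: "Pr \<in> irr_ext G Pa Xs M"
    and R: "R \<subseteq> G" "ancestral Pa R" and b: "b \<in> PiE G Xs"
    and K: "K \<subseteq> G" "ancestral Pa K" "R \<subseteq> K"
    and Q1: "depends_on R Q1" and Q2: "depends_on (K - R) Q2"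
    and unt: "\<forall>x. Q1 x \<longrightarrow> K \<inter> touched G Pa R b x = {}"
    and ne: "{z \<in> PiE G Xs. Q1 z \<and> Q2 z} \<noteq> {}" "{z \<in> PiE G Xs. (\<forall>r\<in>R. z r = b r) \<and> Q2 z} \<noteq> {}"
  shows "\<exists>Pr' \<in> irr_ext G Pa Xs M. \<forall>Q3. depends_on (K - R) Q3 \<longrightarrow>
      Pr' {z \<in> PiE G Xs. Q3 z} {z \<in> PiE G Xs. Q1 z \<and> Q2 z} =
      Pr {z \<in> PiE G Xs. Q3 z} {z \<in> PiE G Xs. (\<forall>r\<in>R. z r = b r) \<and> Q2 z}"
proof -
  let ?\<Omega> = "PiE G Xs"
  have finG: "finite G" using dag unfolding is_dag_def by simp
  have fin\<Omega>: "finite ?\<Omega>" using spaces finG by (auto intro: finite_PiE)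
  have fcp: "full_cond_prob ?\<Omega> Pr" using Pr unfolding irr_ext_def by simp
  from full_cond_prob_approx[OF fcp fin\<Omega>] obtain p :: "nat \<Rightarrow> ('n \<Rightarrow> 'v) \<Rightarrow> real"
    where p: "\<forall>n. \<forall>x\<in>?\<Omega>. 0 < p n x"
      "\<forall>A B. A \<subseteq> ?\<Omega> \<longrightarrow> B \<subseteq> ?\<Omega> \<longrightarrow> B \<noteq> {} \<longrightarrow> (\<lambda>n. sum (p n) (A \<inter> B) / sum (p n) B) \<longlonglongrightarrow> Pr A B"
    by (elim exE conjE)
  note p_pos = p(1)[rule_format] and p_lim = p(2)[rule_format]
  define \<kappa>0 where "\<kappa>0 s x = (SOME q. q \<in> M s x)" for s x
  \<comment> \<open>The chosen models may have zeros, so they are mixed with a uniform distribution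
    of weight 1/(n+2), strictly between 0 and 1 from the start. The mixtures may leave
    \<open>M\<close>, but their limit is \<open>\<kappa>0\<close>.\<close>
  define e where "e n = 1 / real (Suc (Suc n))" for n
  define \<kappa> where "\<kappa> n s x v = (1 - e n) * \<kappa>0 s x v + e n / real (card (Xs s))" for n s x v
  have e: "0 < e n" "e n < 1" for n unfolding e_def by auto
  have e_lim: "e \<longlonglongrightarrow> 0" unfolding e_def by (intro LIMSEQ_Suc lim_1_over_n)
  have M: "M s x \<noteq> {}" "M s x \<subseteq> pmfs_on (Xs s)" "convex_fun_set (M s x)" if "s \<in> G" "x \<in> PiE (Pa s) Xs" for s x
    using models that unfolding local_models_ok_def by auto
  have \<kappa>0: "\<kappa>0 s x \<in> M s x" if "s \<in> G" "x \<in> PiE (Pa s) Xs" for s x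
    unfolding \<kappa>0_def using M(1)[OF that] by (simp add: some_in_eq)
  have pmf: "0 \<le> \<kappa>0 s x v" "v \<notin> Xs s \<Longrightarrow> \<kappa>0 s x v = 0" "(\<Sum>v\<in>Xs s. \<kappa>0 s x v) = 1"
    if "s \<in> G" "x \<in> PiE (Pa s) Xs" for s x v
  proof -
    have "\<kappa>0 s x \<in> pmfs_on (Xs s)" using \<kappa>0[OF that] M(2)[OF that] by blast
    then show "0 \<le> \<kappa>0 s x v" "v \<notin> Xs s \<Longrightarrow> \<kappa>0 s x v = 0" "(\<Sum>v\<in>Xs s. \<kappa>0 s x v) = 1"
      unfolding pmfs_on_def by (cases "v \<in> Xs s"; auto)+
  qed
  have card: "0 < card (Xs s)" if "s \<in> G" for s using spaces that by (simp add: card_gt_0_iff)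
  have \<kappa>_lim: "(\<lambda>n. \<kappa> n s x v) \<longlonglongrightarrow> \<kappa>0 s x v" for s x v
  proof -
    have "(\<lambda>n. (1 - e n) * \<kappa>0 s x v + e n / real (card (Xs s))) \<longlonglongrightarrow> (1 - 0) * \<kappa>0 s x v + 0 / real (card (Xs s))"
      unfolding divide_inverse by (intro tendsto_intros e_lim)
    then show ?thesis unfolding \<kappa>_def by simp
  qed
  interpret glued_weights G Pa Xs R b "\<kappa> n" "p n" for n
  proof
    fix s x assume s: "s \<in> G" "x \<in> PiE (Pa s) Xs"
    show "0 < \<kappa> n s x v" for v
      unfolding \<kappa>_def using e[of n] pmf(1)[OF s] card[OF s(1)] by (intro add_nonneg_pos) auto
    show "(\<Sum>v\<in>Xs s. \<kappa> n s x v) = 1"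
      unfolding \<kappa>_def using pmf(3)[OF s] card[OF s(1)] by (simp add: sum.distrib sum_distrib_left[symmetric])
  qed (use dag spaces R b p_pos in auto)
  have GG: "ancestral Pa G" using dag unfolding ancestral_def is_dag_def by auto
  have "\<exists>Pr r. full_cond_prob ?\<Omega> Pr \<and> strict_mono (r :: nat \<Rightarrow> nat) \<and>
    (\<forall>A B. A \<subseteq> ?\<Omega> \<longrightarrow> B \<subseteq> ?\<Omega> \<longrightarrow> B \<noteq> {} \<longrightarrow>
       (\<lambda>n. sum (W (r n) G) (A \<inter> B) / sum (W (r n) G) B) \<longlonglongrightarrow> Pr A B)"
    by (rule full_cond_prob_limit[OF fin\<Omega>]) (rule W_pos[OF order.refl GG])
  then obtain Pr' and r :: "nat \<Rightarrow> nat" where Pr': "full_cond_prob ?\<Omega> Pr'" and r: "strict_mono r"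
    and lim: "\<forall>A B. A \<subseteq> ?\<Omega> \<longrightarrow> B \<subseteq> ?\<Omega> \<longrightarrow> B \<noteq> {} \<longrightarrow>
       (\<lambda>n. sum (W (r n) G) (A \<inter> B) / sum (W (r n) G) B) \<longlonglongrightarrow> Pr' A B"
    by (elim exE conjE)
  note lim = lim[rule_format]
  have p_lim': "(\<lambda>n. sum (p (r n)) (A \<inter> B) / sum (p (r n)) B) \<longlonglongrightarrow> Pr A B"
    if "A \<subseteq> ?\<Omega>" "B \<subseteq> ?\<Omega>" "B \<noteq> {}" for A B
    using LIMSEQ_subseq_LIMSEQ[OF p_lim[OF that] r] unfolding o_def .
  have "Pr' \<in> irr_ext G Pa Xs M"
    unfolding irr_ext_def
  proof (intro CollectI conjI ballI Pr')
    fix s x assume s: "s \<in> G" and x: "x \<in> PiE (nondesc G Pa s) Xs"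
    let ?N = "nondesc G Pa s"
    let ?y = "restrict x (Pa s)"
    let ?D = "{z \<in> ?\<Omega>. \<forall>t\<in>?N. z t = x t}"
    let ?B = "agree ?\<Omega> R b (?N - R - touched G Pa R b x) x"
    note N = ancestral_nondesc[OF dag s]
    have y: "?y \<in> PiE (Pa s) Xs" using x N(3) by auto
    have "(\<lambda>t. if t \<in> ?N then x t else b t) \<in> ?D" using x b N(4) by (auto simp: PiE_iff extensional_def)
    then have D: "?D \<subseteq> ?\<Omega>" "?D \<noteq> {}" by auto
    have limv: "(\<lambda>n. if s \<in> R \<union> touched G Pa R b x then \<kappa> (r n) s ?y v
        else sum (p (r n)) ({z \<in> ?\<Omega>. z s = v} \<inter> ?B) / sum (p (r n)) ?B)
      \<longlonglongrightarrow> Pr' {z \<in> ?\<Omega>. z s = v} ?D" if v: "v \<in> Xs s" for v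
    proof -
      have "{z \<in> ?\<Omega>. z s = v} \<inter> ?D = {z \<in> ?\<Omega>. z s = v \<and> (\<forall>t\<in>?N. z t = x t)}" by auto
      then show ?thesis using lim[OF _ D, of "{z \<in> ?\<Omega>. z s = v}"] unfolding W_local[OF s x v, symmetric] by simp
    qed
    show "(\<lambda>v. if v \<in> Xs s then Pr' {z \<in> ?\<Omega>. z s = v} ?D else 0) \<in> M s ?y"
    proof (cases "s \<in> R \<union> touched G Pa R b x")
      case True
      have "Pr' {z \<in> ?\<Omega>. z s = v} ?D = \<kappa>0 s ?y v" if "v \<in> Xs s" for v
        using limv[OF that] LIMSEQ_subseq_LIMSEQ[OF \<kappa>_lim r, of s ?y v] True
        by (auto simp: o_def intro: LIMSEQ_unique)
      then have "(\<lambda>v. if v \<in> Xs s then Pr' {z \<in> ?\<Omega>. z s = v} ?D else 0) = \<kappa>0 s ?y"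
        using pmf(2)[OF s y] by (auto simp: fun_eq_iff)
      then show ?thesis using \<kappa>0[OF s y] by simp
    next
      case False
      \<comment> \<open>A descendant of \<open>s\<close> in the ancestral set \<open>R\<close> would
        pull \<open>s\<close> into \<open>R\<close>. Thus conditioning on \<open>b\<close> over
        \<open>R\<close> is decided by nondescendants of \<open>s\<close>.\<close>
      have RN: "R \<subseteq> ?N"
      proof
        fix t assume t: "t \<in> R"
        have "(s, t) \<notin> (edges G Pa)\<^sup>*" using ancestral_edges[OF R(2) t, of s] False by auto
        then show "t \<in> ?N" using t R(1) unfolding nondesc_def desc_def by (auto simp: rtrancl_eq_or_trancl)
      qed
      have "(\<lambda>t. if t \<in> R then b t else if t \<in> ?N then x t else b t) \<in> ?B"
        using x b N(4) unfolding agree_def by (auto simp: PiE_iff extensional_def)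
      then have B: "?B \<subseteq> ?\<Omega>" "?B \<noteq> {}" unfolding agree_def by blast+
      have "Pr' {z \<in> ?\<Omega>. z s = v} ?D = Pr {z \<in> ?\<Omega>. z s = v} ?B" if "v \<in> Xs s" for v
        using limv[OF that] p_lim'[OF _ B, of "{z \<in> ?\<Omega>. z s = v}"] False by (auto intro: LIMSEQ_unique)
      then have "(\<lambda>v. if v \<in> Xs s then Pr' {z \<in> ?\<Omega>. z s = v} ?D else 0)
          = (\<lambda>v. if v \<in> Xs s then Pr {z \<in> ?\<Omega>. z s = v} ?B else 0)" by auto
      moreover have "(\<lambda>v. if v \<in> Xs s then Pr {z \<in> ?\<Omega>. z s = v} ?B else 0) \<in> M s ?y"
      proof (rule irr_ext_coarse[OF dag _ Pr s M(3)[OF s y] _ B(2)])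
        show "?B = {z \<in> ?\<Omega>. (\<forall>r\<in>R. z r = b r) \<and> (\<forall>t\<in>?N - R - touched G Pa R b x. z t = x t)}"
          unfolding agree_def by simp
        show "depends_on ?N (\<lambda>z. (\<forall>r\<in>R. z r = b r) \<and> (\<forall>t\<in>?N - R - touched G Pa R b x. z t = x t))"
          using RN by (intro depends_on_conj depends_on_agree) auto
        show "restrict z (Pa s) = ?y" if "z \<in> ?B" for z
        proof
          fix t
          have "z t = x t" if t: "t \<in> Pa s"
          proof (cases "t \<in> R")
            case True
            then show ?thesis using \<open>z \<in> ?B\<close> untouched_parents(1)[of s R G Pa b x t] False s t unfolding agree_def by auto
          next
            case tR: False
            then have "t \<notin> touched G Pa R b x" using untouched_parents(2)[of s R G Pa b x t] False s t by auto
            then show ?thesis using \<open>z \<in> ?B\<close> N(3) t tR unfolding agree_def by auto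
          qed
          then show "restrict z (Pa s) t = ?y t" by simp
        qed
      qed (use spaces in auto)
      ultimately show ?thesis by simp
    qed
  qed
  moreover
  have "Pr' {z \<in> ?\<Omega>. Q3 z} {z \<in> ?\<Omega>. Q1 z \<and> Q2 z} = Pr {z \<in> ?\<Omega>. Q3 z} {z \<in> ?\<Omega>. (\<forall>r\<in>R. z r = b r) \<and> Q2 z}"
    if Q3: "depends_on (K - R) Q3" for Q3
  proof -
    let ?B = "{z \<in> ?\<Omega>. Q1 z \<and> Q2 z}" and ?B' = "{z \<in> ?\<Omega>. (\<forall>r\<in>R. z r = b r) \<and> Q2 z}"
    let ?c = "\<lambda>n. \<Sum>x\<in>{x \<in> PiE R Xs. Q1 x}. \<Prod>s\<in>R. \<kappa> n s (restrict x (Pa s)) (x s)"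
    note ev = W_untouched_event[OF K Q1 depends_on_conj[OF Q3 Q2] unt] W_untouched_event[OF K Q1 Q2 unt]
    have "{z \<in> ?\<Omega>. Q3 z} \<inter> ?B = {z \<in> ?\<Omega>. Q1 z \<and> (Q3 z \<and> Q2 z)}"
      "{z \<in> ?\<Omega>. Q3 z} \<inter> ?B' = {z \<in> ?\<Omega>. (\<forall>r\<in>R. z r = b r) \<and> (Q3 z \<and> Q2 z)}" by auto
    then have ev': "sum (W n G) ({z \<in> ?\<Omega>. Q3 z} \<inter> ?B) = ?c n * sum (p n) ({z \<in> ?\<Omega>. Q3 z} \<inter> ?B')"
      "sum (W n G) ?B = ?c n * sum (p n) ?B'" for n
      using ev by simp_all
    have pos: "0 < sum (W n G) ?B" for n
    proof (rule sum_pos)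
      show "finite ?B" using fin\<Omega> by simp
      show "?B \<noteq> {}" by (rule ne(1))
      show "0 < W n G x" if "x \<in> ?B" for x by (rule W_pos[OF order.refl GG]) (use that in simp)
    qed
    have "?c n \<noteq> 0" for n using pos[of n] unfolding ev'(2) by (rule contrapos_pn) simp
    then have "sum (W n G) ({z \<in> ?\<Omega>. Q3 z} \<inter> ?B) / sum (W n G) ?B =
        sum (p n) ({z \<in> ?\<Omega>. Q3 z} \<inter> ?B') / sum (p n) ?B'" for n unfolding ev' by simp
    then show ?thesis
      using lim[OF _ _ ne(1), of "{z \<in> ?\<Omega>. Q3 z}"] p_lim'[OF _ _ ne(2), of "{z \<in> ?\<Omega>. Q3 z}"]
      by (auto intro: LIMSEQ_unique)
  qed
  ultimately show ?thesis by (intro bexI[of _ Pr'] allI impI)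
qed

section \<open>Irrelevance\<close>

text \<open>Neither infimum has to be attained, and empty sets are allowed, so nonemptiness of the
  extension need not be established.\<close>

lemma cInf_eq_of_mutual_bounds:
  fixes X Y :: "real set"
  assumes "\<And>x. x \<in> X \<Longrightarrow> \<exists>y\<in>Y. y \<le> x" "\<And>y. y \<in> Y \<Longrightarrow> \<exists>x\<in>X. x \<le> y"
    and "bdd_below X" "bdd_below Y"
  shows "Inf X = Inf Y"
proof (cases "X = {}")
  case True
  then have "Y = {}" using assms(2) by auto
  then show ?thesis using True by simp
next
  case False
  then have "Y \<noteq> {}" using assms(1) by auto
  show ?thesis
    by (rule antisym; rule cInf_mono) (use False \<open>Y \<noteq> {}\<close> assms in auto)
qed

text \<open>\<open>Q1\<close> and \<open>Q1'\<close> enter symmetrically, both fixing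
  \<open>xC\<close> on \<open>C \<inter> R\<close>. Exchanging them yields the two inequalities
  between the infima.\<close>

lemma irr_ext_transfer:
  fixes G :: "'n set" and Xs :: "'n \<Rightarrow> 'v set"
  assumes dag: "is_dag G Pa" and spaces: "\<forall>s\<in>G. finite (Xs s) \<and> Xs s \<noteq> {}"
    and models: "local_models_ok G Pa Xs M" and Pr: "Pr \<in> irr_ext G Pa Xs M"
    and RK: "R \<subseteq> K" "K \<subseteq> G" "ancestral Pa R" "ancestral Pa K" and S: "S \<subseteq> K - R"
    and C: "\<forall>t\<in>K - R. Pa t \<inter> R \<subseteq> C"
    and Q1: "depends_on R Q1" and Q1': "depends_on R Q1'" and Q2: "depends_on (K - R) Q2"
    and QC: "\<forall>x. Q1 x \<longrightarrow> (\<forall>c\<in>C \<inter> R. x c = xC c)" "\<forall>x. Q1' x \<longrightarrow> (\<forall>c\<in>C \<inter> R. x c = xC c)"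
    and ne: "{z \<in> PiE G Xs. Q1 z \<and> Q2 z} \<noteq> {}" "{z \<in> PiE G Xs. Q1' z \<and> Q2 z} \<noteq> {}"
  shows "\<exists>Pr' \<in> irr_ext G Pa Xs M.
    (\<Sum>zS\<in>PiE S Xs. f zS * Pr' {z \<in> PiE G Xs. restrict z S = zS} {z \<in> PiE G Xs. Q1' z \<and> Q2 z})
    \<le> (\<Sum>zS\<in>PiE S Xs. f zS * Pr {z \<in> PiE G Xs. restrict z S = zS} {z \<in> PiE G Xs. Q1 z \<and> Q2 z})"
proof -
  let ?\<Omega> = "PiE G Xs"
  let ?B = "{z \<in> ?\<Omega>. Q1 z \<and> Q2 z}" and ?B' = "{z \<in> ?\<Omega>. Q1' z \<and> Q2 z}"
  have fin: "finite ?\<Omega>" using spaces dag unfolding is_dag_def by (auto intro: finite_PiE)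
  have P: "full_cond_prob ?\<Omega> Pr" "?B \<subseteq> ?\<Omega>" "?B \<noteq> {}" using Pr ne(1) unfolding irr_ext_def by auto
  have "\<exists>b\<in>?B. (\<Sum>zS\<in>PiE S Xs. f zS * Pr {z \<in> ?\<Omega>. restrict z S = zS} {z \<in> ?B. restrict z R = restrict b R})
      \<le> (\<Sum>zS\<in>PiE S Xs. f zS * Pr {z \<in> ?\<Omega>. restrict z S = zS} ?B)"
    by (rule full_cond_prob_expectation_ge_some[OF P fin]) auto
  then obtain b where b: "b \<in> ?B" and
    le: "(\<Sum>zS\<in>PiE S Xs. f zS * Pr {z \<in> ?\<Omega>. restrict z S = zS} {z \<in> ?B. restrict z R = restrict b R})
      \<le> (\<Sum>zS\<in>PiE S Xs. f zS * Pr {z \<in> ?\<Omega>. restrict z S = zS} ?B)" by blast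
  let ?Bb = "{z \<in> ?\<Omega>. (\<forall>r\<in>R. z r = b r) \<and> Q2 z}"
  have restr: "restrict z R = restrict b R \<longleftrightarrow> (\<forall>r\<in>R. z r = b r)" for z
    by (metis restrict_apply' restrict_ext)
  have "Q1 z" if "\<forall>r\<in>R. z r = b r" for z
    using depends_onD[OF Q1, of z b] that b by simp
  then have Bb: "{z \<in> ?B. restrict z R = restrict b R} = ?Bb" unfolding restr by auto
  have "b \<in> ?Bb" using b by simp
  then have ne_b: "?Bb \<noteq> {}" by blast
  have b\<Omega>: "b \<in> ?\<Omega>" and RG: "R \<subseteq> G" using b RK by auto
  \<comment> \<open>\<open>b\<close> satisfies \<open>Q1\<close> and \<open>x\<close> satisfies
    \<open>Q1'\<close>, so both carry the values \<open>xC\<close> on \<open>C \<inter> R\<close>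
    and no deviation reaches \<open>K\<close>.\<close>
  have "\<forall>x. Q1' x \<longrightarrow> K \<inter> touched G Pa R b x = {}"
  proof (intro allI impI)
    fix x assume "Q1' x"
    then have "x c = b c" if "c \<in> C \<inter> R" for c
      using QC(1)[rule_format, of b c] QC(2)[rule_format, of x c] b that by simp
    then show "K \<inter> touched G Pa R b x = {}" by (intro touched_empty[OF RK(4) C]) blast
  qed
  from irr_ext_glue[OF dag spaces models Pr RG RK(3) b\<Omega> RK(2,4,1) Q1' Q2 this ne(2) ne_b]
  obtain Pr' where Pr': "Pr' \<in> irr_ext G Pa Xs M"
    and glue: "\<forall>Q3. depends_on (K - R) Q3 \<longrightarrow>
      Pr' {z \<in> ?\<Omega>. Q3 z} ?B' = Pr {z \<in> ?\<Omega>. Q3 z} ?Bb" by (rule bexE)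
  have "Pr' {z \<in> ?\<Omega>. restrict z S = zS} ?B' = Pr {z \<in> ?\<Omega>. restrict z S = zS} ?Bb" for zS
    by (rule glue[rule_format]) (rule depends_on_restrict[OF S])
  then show ?thesis using Pr' le unfolding Bb by (intro bexI[OF _ Pr']) simp
qed

theorem theorem5:
  fixes G :: "'n set" and Pa :: "'n \<Rightarrow> 'n set" and Xs :: "'n \<Rightarrow> 'v set"
    and M :: "'n \<Rightarrow> ('n \<Rightarrow> 'v) \<Rightarrow> ('v \<Rightarrow> real) set"
    and I S C :: "'n set"
  assumes dag: "is_dag G Pa"
    and spaces: "\<forall>s\<in>G. finite (Xs s) \<and> Xs s \<noteq> {}"
    and models: "local_models_ok G Pa Xs M"
    and subs: "I \<subseteq> G" "S \<subseteq> G" "C \<subseteq> G"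
    and disj: "I \<inter> S = {}" "I \<inter> C = {}" "S \<inter> C = {}"
    and sep: "AD_separated G Pa I S C"
  shows "\<forall>(f :: ('n \<Rightarrow> 'v) \<Rightarrow> real) BS xC BI.
           BS \<subseteq> PiE S Xs \<longrightarrow> BS \<noteq> {} \<longrightarrow> xC \<in> PiE C Xs \<longrightarrow>
           BI \<subseteq> PiE I Xs \<longrightarrow> BI \<noteq> {} \<longrightarrow>
           lower_exp_irr G Pa Xs M S f (cond_event3 G Xs S BS C xC I BI)
             = lower_exp_irr G Pa Xs M S f (cond_event2 G Xs S BS C xC)"
proof (intro allI impI)
  fix f :: "('n \<Rightarrow> 'v) \<Rightarrow> real" and BS xC BI
  assume BS: "BS \<subseteq> PiE S Xs" "BS \<noteq> {}" and xC: "xC \<in> PiE C Xs" and BI: "BI \<subseteq> PiE I Xs" "BI \<noteq> {}"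
  let ?\<Omega> = "PiE G Xs"
  obtain R K where RK: "R \<subseteq> K" "K \<subseteq> G" "ancestral Pa R" "ancestral Pa K"
    and ISC: "I \<subseteq> R" "S \<subseteq> K - R" "C \<subseteq> K" and par: "\<forall>t\<in>K - R. Pa t \<inter> R \<subseteq> C"
    using AD_separated_split[OF dag subs disj(2,3) sep] by metis
  \<comment> \<open>The conditioning on \<open>C\<close> is split along \<open>R\<close>: its part
    outside \<open>R\<close> joins \<open>BS\<close> on \<open>K - R\<close>, its part inside
    \<open>R\<close> joins \<open>BI\<close>.\<close>
  define Q2 where "Q2 z \<longleftrightarrow> restrict z S \<in> BS \<and> (\<forall>c\<in>C - R. z c = xC c)" for z :: "'n \<Rightarrow> 'v"
  define QC where "QC z \<longleftrightarrow> (\<forall>c\<in>C \<inter> R. z c = xC c)" for z :: "'n \<Rightarrow> 'v"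
  define QI where "QI z \<longleftrightarrow> QC z \<and> restrict z I \<in> BI" for z :: "'n \<Rightarrow> 'v"
  have e3: "cond_event3 G Xs S BS C xC I BI = {z \<in> ?\<Omega>. QI z \<and> Q2 z}"
    unfolding cond_event3_def Q2_def QC_def QI_def by auto
  have e2: "cond_event2 G Xs S BS C xC = {z \<in> ?\<Omega>. QC z \<and> Q2 z}"
    unfolding cond_event2_def Q2_def QC_def by auto
  have QC: "depends_on R QC" unfolding QC_def by (rule depends_on_agree) auto
  have QI: "depends_on R QI"
    unfolding QI_def by (intro depends_on_conj QC depends_on_restrict ISC(1))
  have Q2: "depends_on (K - R) Q2"
    unfolding Q2_def using ISC(2,3) by (intro depends_on_conj depends_on_restrict depends_on_agree) auto
  have QIC: "\<forall>x. QI x \<longrightarrow> (\<forall>c\<in>C \<inter> R. x c = xC c)" "\<forall>x. QC x \<longrightarrow> (\<forall>c\<in>C \<inter> R. x c = xC c)"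
    unfolding QI_def QC_def by auto
  obtain zS zI z where z: "zS \<in> BS" "zI \<in> BI" "z \<in> ?\<Omega>"
    using BS(2) BI(2) spaces by (metis PiE_eq_empty_iff all_not_in_conv)
  have zSI: "zS \<in> PiE S Xs" "zI \<in> PiE I Xs" using z BS BI by auto
  \<comment> \<open>Disjointness of \<open>S\<close>, \<open>I\<close> and \<open>C\<close> allows
    prescribed states to be pasted together, with \<open>z\<close> filling the other nodes; this
    shows that both conditioning events are nonempty.\<close>
  define w where "w t = (if t \<in> S then zS t else if t \<in> I then zI t else if t \<in> C then xC t else z t)" for t
  have "w \<in> ?\<Omega>" using z zSI xC subs unfolding w_def by (auto simp: PiE_iff extensional_def)
  moreover have "restrict w S = zS"
  proof
    fix t show "restrict w S t = zS t" using PiE_arb[OF zSI(1), of t] unfolding w_def by simp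
  qed
  moreover have "restrict w I = zI"
  proof
    fix t show "restrict w I t = zI t" using PiE_arb[OF zSI(2), of t] disj unfolding w_def by auto
  qed
  moreover have "\<forall>c\<in>C. w c = xC c" using disj unfolding w_def by auto
  ultimately have "w \<in> {z \<in> ?\<Omega>. QI z \<and> Q2 z}" using z unfolding QI_def QC_def Q2_def by auto
  then have ne: "{z \<in> ?\<Omega>. QI z \<and> Q2 z} \<noteq> {}" "{z \<in> ?\<Omega>. QC z \<and> Q2 z} \<noteq> {}" unfolding QI_def by auto
  let ?E = "\<lambda>Pr B. \<Sum>zS\<in>PiE S Xs. f zS * Pr {z \<in> ?\<Omega>. restrict z S = zS} B"
  let ?X = "\<lambda>B. {?E Pr B | Pr. Pr \<in> irr_ext G Pa Xs M}"
  \<comment> \<open>Probabilities lie in [0,1], so each term is at least minus the absolute value of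
    \<open>f\<close>.\<close>
  have bdd: "bdd_below (?X B)" if "B \<subseteq> ?\<Omega>" "B \<noteq> {}" for B
  proof (rule bdd_belowI)
    fix e assume "e \<in> ?X B"
    then obtain Pr where Pr: "Pr \<in> irr_ext G Pa Xs M" "e = ?E Pr B" by blast
    then have P: "full_cond_prob ?\<Omega> Pr" unfolding irr_ext_def by simp
    show "(\<Sum>zS\<in>PiE S Xs. - \<bar>f zS\<bar>) \<le> e"
      unfolding Pr(2)
    proof (rule sum_mono)
      fix zS
      have A: "{z \<in> ?\<Omega>. restrict z S = zS} \<subseteq> ?\<Omega>" by auto
      have "\<bar>f zS * Pr {z \<in> ?\<Omega>. restrict z S = zS} B\<bar> \<le> \<bar>f zS\<bar>"
        using full_cond_prob_nonneg[OF P that A] full_cond_prob_le_1[OF P that A]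
        by (simp add: abs_mult mult_left_le)
      then show "- \<bar>f zS\<bar> \<le> f zS * Pr {z \<in> ?\<Omega>. restrict z S = zS} B" by linarith
    qed
  qed
  note transfer = irr_ext_transfer[OF dag spaces models _ RK ISC(2) par]
  have "Inf (?X {z \<in> ?\<Omega>. QI z \<and> Q2 z}) = Inf (?X {z \<in> ?\<Omega>. QC z \<and> Q2 z})"
  proof (rule cInf_eq_of_mutual_bounds)
    show "bdd_below (?X {z \<in> ?\<Omega>. QI z \<and> Q2 z})" "bdd_below (?X {z \<in> ?\<Omega>. QC z \<and> Q2 z})"
      using ne by (auto intro!: bdd)
  next
    fix e assume "e \<in> ?X {z \<in> ?\<Omega>. QI z \<and> Q2 z}"
    then obtain Pr where Pr: "Pr \<in> irr_ext G Pa Xs M" "e = ?E Pr {z \<in> ?\<Omega>. QI z \<and> Q2 z}" by blast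
    have "\<exists>Pr'\<in>irr_ext G Pa Xs M. ?E Pr' {z \<in> ?\<Omega>. QC z \<and> Q2 z} \<le> e"
      unfolding Pr(2) by (rule transfer[OF Pr(1) QI QC Q2 QIC ne])
    then show "\<exists>y\<in>?X {z \<in> ?\<Omega>. QC z \<and> Q2 z}. y \<le> e" by blast
  next
    fix e assume "e \<in> ?X {z \<in> ?\<Omega>. QC z \<and> Q2 z}"
    then obtain Pr where Pr: "Pr \<in> irr_ext G Pa Xs M" "e = ?E Pr {z \<in> ?\<Omega>. QC z \<and> Q2 z}" by blast
    have "\<exists>Pr'\<in>irr_ext G Pa Xs M. ?E Pr' {z \<in> ?\<Omega>. QI z \<and> Q2 z} \<le> e"
      unfolding Pr(2) by (rule transfer[OF Pr(1) QC QI Q2 QIC(2,1) ne(2,1)])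
    then show "\<exists>x\<in>?X {z \<in> ?\<Omega>. QI z \<and> Q2 z}. x \<le> e" by blast
  qed
  then show "lower_exp_irr G Pa Xs M S f (cond_event3 G Xs S BS C xC I BI)
      = lower_exp_irr G Pa Xs M S f (cond_event2 G Xs S BS C xC)"
    unfolding lower_exp_irr_def e3 e2 .
qed

end
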